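(* Let $k\ge 2$ and let $T$ be a $k$-tree of order $n\ge k+1$. If $n\neq k+2$ and a $k$-clique $C$ of $T$ maximizes $\mu(T;C)$ over all $k$-cliques of $T$, then $C$ has degree $1$. If $n=k+2$, then every $k$-clique $C$ of $T$ satisfies $\mu(T;C)=k+1$.
   Context: A $k$-tree is defined recursively: $K_k$ is a $k$-tree, and if $T$ is a $k$-tree then so is the graph obtained by joining a new vertex to all vertices of some $k$-clique of $T$; there are no others. A sub-$k$-tree of $T$ is a subgraph that is itself a $k$-tree. For a $k$-clique $C$ of $T$, $N(T;C)$ is the number of sub-$k$-trees of $T$ containing $C$, $R(T;C)$ is the sum of their numbers of vertices, and $\mu(T;C)=R(T;C)/N(T;C)$ is the local mean sub-$k$-tree order. The degree of a $k$-clique is the number of $(k+1)$-cliques containing it. *)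

theory Defs
  imports Complex_Main
begin

text \<open>A (simple, finite) graph is given by a vertex set V and a set E of
  2-element vertex sets (edges).\<close>

definition complete_edges :: "'a set \<Rightarrow> 'a set set" where
  "complete_edges S = {e. \<exists>x y. x \<in> S \<and> y \<in> S \<and> x \<noteq> y \<and> e = {x, y}}"

definition is_clique :: "'a set set \<Rightarrow> 'a set \<Rightarrow> bool" where
  "is_clique E S \<longleftrightarrow> complete_edges S \<subseteq> E"

inductive ktree :: "nat \<Rightarrow> 'a set \<Rightarrow> 'a set set \<Rightarrow> bool" for k :: nat where
  base: "finite V \<Longrightarrow> card V = k \<Longrightarrow> ktree k V (complete_edges V)"
| step: "ktree k V E \<Longrightarrow> v \<notin> V \<Longrightarrow> S \<subseteq> V \<Longrightarrow> card S = k \<Longrightarrow> is_clique E S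
         \<Longrightarrow> ktree k (insert v V) (E \<union> {{v, s} | s. s \<in> S})"

definition kclique :: "nat \<Rightarrow> 'a set \<Rightarrow> 'a set set \<Rightarrow> 'a set \<Rightarrow> bool" where
  "kclique k V E C \<longleftrightarrow> C \<subseteq> V \<and> card C = k \<and> is_clique E C"

definition clique_degree :: "nat \<Rightarrow> 'a set \<Rightarrow> 'a set set \<Rightarrow> 'a set \<Rightarrow> nat" where
  "clique_degree k V E C = card {Q. kclique (k + 1) V E Q \<and> C \<subseteq> Q}"

definition sub_ktrees_containing ::
  "nat \<Rightarrow> 'a set \<Rightarrow> 'a set set \<Rightarrow> 'a set \<Rightarrow> ('a set \<times> 'a set set) set" where
  "sub_ktrees_containing k V E C =
     {(V', E'). V' \<subseteq> V \<and> E' \<subseteq> E \<and> ktree k V' E' \<and> C \<subseteq> V' \<and> complete_edges C \<subseteq> E'}"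

definition N_sub :: "nat \<Rightarrow> 'a set \<Rightarrow> 'a set set \<Rightarrow> 'a set \<Rightarrow> nat" where
  "N_sub k V E C = card (sub_ktrees_containing k V E C)"

definition R_sub :: "nat \<Rightarrow> 'a set \<Rightarrow> 'a set set \<Rightarrow> 'a set \<Rightarrow> nat" where
  "R_sub k V E C = (\<Sum>(V', E') \<in> sub_ktrees_containing k V E C. card V')"

definition mu :: "nat \<Rightarrow> 'a set \<Rightarrow> 'a set set \<Rightarrow> 'a set \<Rightarrow> real" where
  "mu k V E C = real (R_sub k V E C) / real (N_sub k V E C)"

end

theory Submission
  imports Defs
begin

text \<open>Sub-\<open>k\<close>-trees containing a \<open>k\<close>-clique \<open>C\<close> are determined by their vertex sets, which are the
  sets grown from \<open>C\<close> by repeatedly attaching a vertex to a \<open>k\<close>-clique. Removing a clique splits the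
  graph into independent parts, so the numbers of such sets multiply and their mean excesses over
  \<open>C\<close> add up. If a \<open>(k+1)\<close>-clique has facets \<open>C\<^sub>i\<close> with \<open>N\<^sub>i\<close> sets of mean excess \<open>m\<^sub>i\<close> beyond
  \<open>C\<^sub>i\<close>, the mean excess at \<open>C\<^sub>i\<close> is \<open>(N\<^sub>i m\<^sub>i + P (1 + S)) / (N\<^sub>i + P)\<close>, where \<open>P\<close> is the product of
  the \<open>N\<^sub>j\<close> and \<open>S\<close> the sum of the \<open>m\<^sub>j\<close>.

  Let \<open>C\<close> have degree at least 2. If some neighbouring facet has degree 1, comparing it with \<open>C\<close> and
  using \<open>N \<ge> 1 + 2 m\<close> shows that \<open>C\<close> is not maximal, except when the graph has order \<open>k + 2\<close>.
  Otherwise let \<open>N\<close> and \<open>m\<close> be the number and mean excess belonging to a branch at \<open>C\<close>: moving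
  from \<open>C\<close> into the branch minimizing \<open>N / (1 + m)\<close> strictly increases the mean at a suitable facet.\<close>

section \<open>Cliques, and the shape of one construction step of a k-tree\<close>

lemma is_clique_iff: "is_clique E S \<longleftrightarrow> (\<forall>x\<in>S. \<forall>y\<in>S. x \<noteq> y \<longrightarrow> {x, y} \<in> E)"
  unfolding is_clique_def complete_edges_def by blast

lemma is_cliqueD: "is_clique E S \<Longrightarrow> x \<in> S \<Longrightarrow> y \<in> S \<Longrightarrow> x \<noteq> y \<Longrightarrow> {x, y} \<in> E"
  unfolding is_clique_iff by blast

lemma is_clique_subset: "is_clique E S \<Longrightarrow> S' \<subseteq> S \<Longrightarrow> is_clique E S'"
  unfolding is_clique_iff by blast

lemma is_clique_mono: "is_clique E S \<Longrightarrow> E \<subseteq> E' \<Longrightarrow> is_clique E' S"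
  unfolding is_clique_iff by blast

lemma is_clique_insert:
  "is_clique E (insert v S) \<longleftrightarrow> is_clique E S \<and> (\<forall>s\<in>S. s \<noteq> v \<longrightarrow> {v, s} \<in> E)"
  unfolding is_clique_iff by (auto simp: insert_commute)

lemma complete_edges_card: "complete_edges S = {e. e \<subseteq> S \<and> card e = 2}"
  unfolding complete_edges_def card_2_iff by blast

lemma card_complete_edges: "finite S \<Longrightarrow> card (complete_edges S) = card S choose 2"
  unfolding complete_edges_card by (rule n_subsets)

lemma ktree_basic:
  assumes "ktree k V E"
  shows "finite V \<and> k \<le> card V \<and> E \<subseteq> {e. e \<subseteq> V \<and> card e = 2}"
  using assms
proof induction
  case (base V)
  then show ?case by (auto simp: complete_edges_card)
next
  case (step V E v S)
  have "card {v, s} = 2" if "s \<in> S" for s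
    using that step by (metis card_2_iff subsetD)
  then show ?case using step by auto
qed

lemma ktree_finite: "ktree k V E \<Longrightarrow> finite V"
  and ktree_card: "ktree k V E \<Longrightarrow> k \<le> card V"
  and ktree_edges: "ktree k V E \<Longrightarrow> e \<in> E \<Longrightarrow> e \<subseteq> V \<and> card e = 2"
  using ktree_basic by blast+

lemma ktree_edge_vertex: "ktree k V E \<Longrightarrow> {x, y} \<in> E \<Longrightarrow> x \<in> V \<and> y \<in> V \<and> x \<noteq> y"
  using ktree_edges[of k V E "{x, y}"] by auto

lemma star_edge_iff:
  assumes "ktree k V E" "v \<notin> V" "S \<subseteq> V"
  shows "{v, y} \<in> E \<union> {{v, s} | s. s \<in> S} \<longleftrightarrow> y \<in> S"
    and "x \<noteq> v \<Longrightarrow> y \<noteq> v \<Longrightarrow> {x, y} \<in> E \<union> {{v, s} | s. s \<in> S} \<longleftrightarrow> {x, y} \<in> E"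
proof -
  have "{v, y} \<notin> E" using ktree_edge_vertex[OF assms(1)] assms(2) by blast
  then show "{v, y} \<in> E \<union> {{v, s} | s. s \<in> S} \<longleftrightarrow> y \<in> S"
    by (auto simp: doubleton_eq_iff)
  show "x \<noteq> v \<Longrightarrow> y \<noteq> v \<Longrightarrow> {x, y} \<in> E \<union> {{v, s} | s. s \<in> S} \<longleftrightarrow> {x, y} \<in> E"
    by (auto simp: doubleton_eq_iff)
qed

lemma star_clique_old:
  assumes "ktree k V E" "v \<notin> V" "S \<subseteq> V" "v \<notin> C"
  shows "is_clique (E \<union> {{v, s} | s. s \<in> S}) C \<longleftrightarrow> is_clique E C"
proof
  assume *: "is_clique (E \<union> {{v, s} | s. s \<in> S}) C"
  show "is_clique E C" unfolding is_clique_iff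
  proof (intro ballI impI)
    fix x y assume xy: "x \<in> C" "y \<in> C" "x \<noteq> y"
    then have "{x, y} \<in> E \<union> {{v, s} | s. s \<in> S}" by (rule is_cliqueD[OF *])
    moreover have "x \<noteq> v" "y \<noteq> v" using xy assms(4) by blast+
    ultimately show "{x, y} \<in> E" using star_edge_iff(2)[OF assms(1-3), of x y] by simp
  qed
qed (erule is_clique_mono, blast)

lemma star_clique_apex:
  "is_clique E S \<Longrightarrow> is_clique (E \<union> {{v, s} | s. s \<in> S}) (insert v S)"
  unfolding is_clique_insert by (auto intro: is_clique_mono)

lemma star_clique_new:
  assumes "ktree k V E" "v \<notin> V" "S \<subseteq> V" "v \<in> C"
    and "is_clique (E \<union> {{v, s} | s. s \<in> S}) C"
  shows "C - {v} \<subseteq> S"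
proof
  fix y assume "y \<in> C - {v}"
  then have "{v, y} \<in> E \<union> {{v, s} | s. s \<in> S}" by (intro is_cliqueD[OF assms(5,4)]) auto
  then show "y \<in> S" using star_edge_iff(1)[OF assms(1-3)] by blast
qed

section \<open>Edge counts: sub-k-trees are induced subgraphs\<close>

lemma card_ktree_edges: "ktree k V E \<Longrightarrow> card E = k * (card V - k) + (k choose 2)"
proof (induction rule: ktree.induct)
  case (base V)
  then show ?case by (simp add: card_complete_edges)
next
  case (step V E v S)
  note f = ktree_finite[OF step.hyps(1)] 
  have "{{v, s} | s. s \<in> S} = (\<lambda>s. {v, s}) ` S" by blast
  moreover have fS: "finite S" using step.hyps(3) f by (rule finite_subset)
  moreover have "inj_on (\<lambda>s. {v, s}) S" by (auto simp: inj_on_def doubleton_eq_iff)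
  ultimately have c: "finite {{v, s} | s. s \<in> S}" "card {{v, s} | s. s \<in> S} = k"
    using step.hyps(4) by (simp_all add: card_image)
  have fE: "finite E" using ktree_basic[OF step.hyps(1)] f
    by (meson finite_Pow_iff finite_subset PowI subsetI ktree_edges[OF step.hyps(1)])
  have "E \<inter> {{v, s} | s. s \<in> S} = {}" using ktree_edge_vertex[OF step.hyps(1)] step.hyps(2) by blast
  then have "card (E \<union> {{v, s} | s. s \<in> S}) = card E + k"
    using c fE by (simp add: card_Un_disjoint)
  moreover have "card (insert v V) - k = Suc (card V - k)"
    using step f ktree_card[OF step.hyps(1)] by simp
  ultimately show ?case using step by simp
qed

text \<open>Following the construction, deleting the newest vertex from \<open>Y\<close> loses at
  most \<open>k\<close> edges. By \<open>card_ktree_edges\<close>, the bound is the number of edges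
  of a k-tree on as many vertices.\<close>

lemma card_induced_edges_le:
  assumes "ktree k V E" "Y \<subseteq> V" "k \<le> card Y"
  shows "card {e \<in> E. e \<subseteq> Y} \<le> k * (card Y - k) + (k choose 2)"
  using assms
proof (induction arbitrary: Y rule: ktree.induct)
  case (base V)
  have "Y = V" using base by (simp add: card_seteq)
  then show ?case using base card_complete_edges[of V]
    by (simp add: complete_edges_card conj_commute)
next
  case (step V E v S)
  note fin = ktree_finite[OF step.hyps(1)]
  have fY: "finite Y" using step.prems(1) fin finite_subset by blast
  show ?case
  proof (cases "card Y = k")
    \<comment> \<open>Here \<open>Y - {v}\<close> may have only \<open>k - 1\<close> vertices, which
      the induction hypothesis does not cover; counting all pairs in \<open>Y\<close> already gives
      the claim.\<close>
    case True
    have "{e \<in> E \<union> {{v, s} | s. s \<in> S}. e \<subseteq> Y} \<subseteq> complete_edges Y"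
      using ktree_edges[OF ktree.step[OF step.hyps(1-5)]] unfolding complete_edges_card by blast
    moreover have "finite (complete_edges Y)" using fY
      by (auto simp: complete_edges_card)
    ultimately have "card {e \<in> E \<union> {{v, s} | s. s \<in> S}. e \<subseteq> Y} \<le> card (complete_edges Y)"
      by (rule card_mono[rotated])
    then show ?thesis using fY True card_complete_edges[of Y] by simp
  next
    case False
    then have kY: "k < card Y" using step.prems(2) by simp
    have fE: "finite E" using fin by (meson PowI finite_Pow_iff finite_subset ktree_edges[OF step.hyps(1)] subsetI)
    show ?thesis
    proof (cases "v \<in> Y")
      case False
      then have "{e \<in> E \<union> {{v, s} | s. s \<in> S}. e \<subseteq> Y} = {e \<in> E. e \<subseteq> Y}" by blast
      moreover have "Y \<subseteq> V" using step.prems(1) False by blast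
      ultimately show ?thesis using step.IH step.prems(2) by presburger
    next
      case True
      let ?Z = "Y - {v}"
      have "{e \<in> E \<union> {{v, s} | s. s \<in> S}. e \<subseteq> Y} \<subseteq> {e \<in> E. e \<subseteq> ?Z} \<union> (\<lambda>s. {v, s}) ` S"
        using ktree_edges[OF step.hyps(1)] step.hyps(2) by blast
      then have "card {e \<in> E \<union> {{v, s} | s. s \<in> S}. e \<subseteq> Y} \<le> card ({e \<in> E. e \<subseteq> ?Z} \<union> (\<lambda>s. {v, s}) ` S)"
        using fE fin step.hyps(3) by (intro card_mono) (auto intro: finite_subset)
      also have "\<dots> \<le> card {e \<in> E. e \<subseteq> ?Z} + card ((\<lambda>s. {v, s}) ` S)" by (rule card_Un_le)
      also have "card ((\<lambda>s. {v, s}) ` S) \<le> k"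
        using step card_image_le[of S] fin finite_subset by metis
      also have "card {e \<in> E. e \<subseteq> ?Z} \<le> k * (card ?Z - k) + (k choose 2)"
        using step kY True fY by (intro step.IH) auto
      finally have "card {e \<in> E \<union> {{v, s} | s. s \<in> S}. e \<subseteq> Y} \<le> k * (card ?Z - k) + (k choose 2) + k"
        by simp
      moreover have "card Y - k = Suc (card ?Z - k)" using kY True fY by simp
      ultimately show ?thesis by simp
    qed
  qed
qed

text \<open>\<open>E'\<close> lies among the induced edges and already has the largest number of
  edges that \<open>V'\<close> can span, so no induced edge is missing.\<close>

lemma sub_ktree_induced:
  assumes "ktree k V E" "ktree k V' E'" "V' \<subseteq> V" "E' \<subseteq> E"
  shows "E' = {e \<in> E. e \<subseteq> V'}"
proof (rule card_seteq)
  show "finite {e \<in> E. e \<subseteq> V'}"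
    using ktree_finite[OF assms(2)] by (auto intro: finite_subset[of _ "Pow V'"])
  show "E' \<subseteq> {e \<in> E. e \<subseteq> V'}" using ktree_edges[OF assms(2)] assms(4) by blast
  show "card {e \<in> E. e \<subseteq> V'} \<le> card E'"
    using card_induced_edges_le[OF assms(1,3)] ktree_card[OF assms(2)] card_ktree_edges[OF assms(2)]
    by simp
qed

section \<open>Sub-k-trees as vertex sets grown from a clique\<close>

inductive grow :: "nat \<Rightarrow> 'a set set \<Rightarrow> 'a set \<Rightarrow> 'a set \<Rightarrow> bool" for k E K where
  start: "grow k E K K"
| add: "grow k E K X \<Longrightarrow> S \<subseteq> X \<Longrightarrow> card S = k \<Longrightarrow> is_clique E (insert v S) \<Longrightarrow> grow k E K (insert v X)"

lemma grow_superset: "grow k E K X \<Longrightarrow> K \<subseteq> X"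
  by (induction rule: grow.induct) auto

lemma grow_mono_edges: "grow k E K X \<Longrightarrow> E \<subseteq> E' \<Longrightarrow> grow k E' K X"
  by (induction rule: grow.induct) (auto intro: grow.intros is_clique_mono)

text \<open>The steps leading from \<open>K\<close> to \<open>X\<close> are replayed on top of
  \<open>Y\<close>, where every attaching clique is still present. For this the rule
  \<open>add\<close> allows \<open>v\<close> to lie in \<open>X\<close> already.\<close>

lemma grow_Un:
  assumes "grow k E K X" "grow k E L Y" "K \<subseteq> Y"
  shows "grow k E L (X \<union> Y)"
  using assms
proof (induction rule: grow.induct)
  case start
  then show ?case by (simp add: Un_absorb1)
next
  case (add X S v)
  then have "grow k E L (insert v (X \<union> Y))" by (intro grow.add[of _ _ _ _ S]) auto
  then show ?case by simp
qed

lemma ktree_grow: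
  assumes "ktree k V E" "C \<subseteq> V" "card C = k" "is_clique E C"
  shows "grow k E C V"
  using assms
proof (induction arbitrary: C rule: ktree.induct)
  case (base V)
  then have "C = V" by (simp add: card_seteq)
  then show ?case by (simp add: grow.start)
next
  case (step V E v S)
  let ?E = "E \<union> {{v, s} | s. s \<in> S}"
  have fin: "finite V" using ktree_finite[OF step.hyps(1)] .
  have SE: "is_clique ?E (insert v S)"
    using step.hyps(5) by (rule star_clique_apex)
  show ?case
  proof (cases "v \<in> C")
    case False
    then have "is_clique E C" using star_clique_old[OF step.hyps(1-3)] step.prems(3) by blast
    then have "grow k E C V" using step.IH step.prems False by blast
    then have "grow k ?E C V" by (rule grow_mono_edges) blast
    then show ?thesis using step SE by (intro grow.add) auto
  next
    case True
    have sub: "C - {v} \<subseteq> S" by (rule star_clique_new[OF step.hyps(1-3) True step.prems(3)])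
    have fS: "finite S" using step.hyps(3) fin by (rule finite_subset)
    have fC: "finite C" using fin step.prems(1) finite_subset by blast
    \<comment> \<open>\<open>C\<close> lacks just one vertex \<open>s\<close> of \<open>S\<close>.
      Adding \<open>s\<close> to \<open>C\<close> yields a set containing \<open>S\<close>, on which
      the growth of \<open>V\<close> from \<open>S\<close> is replayed.\<close>
    have "card (S - (C - {v})) = 1"
      using sub True fC step.prems step.hyps card_Suc_Diff1[OF fC True]
      by (subst card_Diff_subset) (auto simp: card_Diff_singleton)
    then obtain s where s: "S - (C - {v}) = {s}" by (auto simp: card_1_singleton_iff)
    have "insert s C \<subseteq> insert v S" using s sub by blast
    then have "is_clique ?E (insert s C)" using SE is_clique_subset by blast
    then have g: "grow k ?E C (insert s C)" using step.prems by (intro grow.add[OF grow.start]) auto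
    have "grow k E S V" using step.IH step.hyps by blast
    then have "grow k ?E S V" by (rule grow_mono_edges) blast
    then have "grow k ?E C (V \<union> insert s C)"
      by (rule grow_Un[OF _ g]) (use s in blast)
    moreover have "V \<union> insert s C = insert v V" using s True step by blast
    ultimately show ?thesis by simp
  qed
qed

lemma grow_ktree:
  assumes "ktree k V E" "C \<subseteq> V" "card C = k" "is_clique E C" "k > 0" "grow k E C X"
  shows "X \<subseteq> V \<and> (\<exists>E'\<subseteq>E. ktree k X E' \<and> complete_edges C \<subseteq> E' )"
  using assms(6)
proof induction
  case start
  have "finite C" using assms ktree_finite finite_subset by blast
  then have "ktree k C (complete_edges C)" using assms by (intro ktree.base)
  then show ?case using assms unfolding is_clique_def by blast
next
  case (add X S v)
  show ?case
  proof (cases "v \<in> X")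
    case True
    then show ?thesis using add by (simp add: insert_absorb)
  next
    case False
    obtain s where s: "s \<in> S" using add assms(5) by fastforce
    have vS: "{v, s} \<in> E" if "s \<in> S" for s
      using is_cliqueD[OF add.hyps(4), of v s] that add.hyps(2) False by blast
    then have v: "v \<in> V" using s ktree_edge_vertex[OF assms(1)] by blast
    obtain E' where E': "E' \<subseteq> E" "ktree k X E'" "complete_edges C \<subseteq> E'" using add by blast
    \<comment> \<open>\<open>S\<close> is only known to be a clique of \<open>E\<close>; it is one
      of \<open>E'\<close>, as \<open>ktree.step\<close> demands, because \<open>E'\<close> has all
      edges of \<open>E\<close> inside \<open>X\<close>.\<close>
    have "E' = {e \<in> E. e \<subseteq> X}"
      using sub_ktree_induced[OF assms(1) E'(2) _ E'(1)] add.IH by blast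
    then have "is_clique E' S"
      using is_cliqueD[OF add.hyps(4)] add.hyps(2) unfolding is_clique_iff by auto
    then have "ktree k (insert v X) (E' \<union> {{v, s} | s. s \<in> S})"
      by (rule ktree.step[OF E'(2) False add.hyps(2,3)])
    moreover have "E' \<union> {{v, s} | s. s \<in> S} \<subseteq> E" using E' vS by blast
    moreover have "complete_edges C \<subseteq> E' \<union> {{v, s} | s. s \<in> S}" using E'(3) by blast
    ultimately show ?thesis using v add.IH by blast
  qed
qed

text \<open>This allows sub-k-trees to be replaced by grown sets. Injectivity is
  \<open>sub_ktree_induced\<close>; the two inclusions are \<open>ktree_grow\<close> and
  \<open>grow_ktree\<close>.\<close>

lemma sub_ktrees_grow:
  assumes "ktree k V E" "C \<subseteq> V" "card C = k" "is_clique E C" "k > 0"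
  shows "bij_betw fst (sub_ktrees_containing k V E C) {X. grow k E C X}"
  unfolding bij_betw_def
proof
  show "inj_on fst (sub_ktrees_containing k V E C)"
  proof (rule inj_onI)
    fix p q
    assume pq: "p \<in> sub_ktrees_containing k V E C" "q \<in> sub_ktrees_containing k V E C" "fst p = fst q"
    have "snd p = {e \<in> E. e \<subseteq> fst p}" "snd q = {e \<in> E. e \<subseteq> fst q}"
      by (rule sub_ktree_induced[OF assms(1)]; use pq(1,2) in \<open>auto simp: sub_ktrees_containing_def\<close>)+
    then show "p = q" using pq(3) by (simp add: prod_eq_iff)
  qed
  show "fst ` sub_ktrees_containing k V E C = {X. grow k E C X}"
  proof (intro subset_antisym subsetI)
    fix X assume "X \<in> fst ` sub_ktrees_containing k V E C"
    then obtain E' where E': "X \<subseteq> V" "E' \<subseteq> E" "ktree k X E'" "C \<subseteq> X" "complete_edges C \<subseteq> E'"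
      unfolding sub_ktrees_containing_def by auto
    then have "grow k E' C X" using assms by (intro ktree_grow) (auto simp: is_clique_def)
    then show "X \<in> {X. grow k E C X}" using grow_mono_edges E' by blast
  next
    fix X assume "X \<in> {X. grow k E C X}"
    then have X: "grow k E C X" by simp
    obtain E' where "X \<subseteq> V" "E' \<subseteq> E" "ktree k X E'" "complete_edges C \<subseteq> E'"
      using grow_ktree[OF assms X] by blast
    then have "(X, E') \<in> sub_ktrees_containing k V E C"
      using grow_superset[OF X] unfolding sub_ktrees_containing_def by blast
    then show "X \<in> fst ` sub_ktrees_containing k V E C" by force
  qed
qed

section \<open>Labels that separate the graph along a clique\<close>

text \<open>If a vertex \<^term>\<open>u\<close> lies beyond the facet \<^term>\<open>B - {b}\<close> of a \<open>(k+1)\<close>-clique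
  \<^term>\<open>B\<close>, its label is \<^term>\<open>b\<close>.\<close>

lemma clique_labelling:
  assumes "ktree k V E" "B \<subseteq> V" "card B = k + 1" "is_clique E B"
  shows "\<exists>f. (\<forall>u\<in>V - B. f u \<in> B \<and> {u, f u} \<notin> E) \<and>
             (\<forall>u\<in>V - B. \<forall>w\<in>V - B. {u, w} \<in> E \<longrightarrow> f u = f w)"
  using assms
proof (induction arbitrary: B rule: ktree.induct)
  case (base V)
  then show ?case using card_mono[of V B] by simp
next
  case (step V E v S)
  let ?E = "E \<union> {{v, s} | s. s \<in> S}"
  note new = star_edge_iff(1)[OF step.hyps(1-3)] and old = star_edge_iff(2)[OF step.hyps(1-3)]
  have new': "{y, v} \<in> ?E \<longleftrightarrow> y \<in> S" for y using new[of y] by (simp only: insert_commute[of y v])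
  have fin: "finite V" using ktree_finite[OF step.hyps(1)] .
  then have fB: "finite B" using step.prems(1) finite_subset by blast
  show ?case
  proof (cases "v \<in> B")
    case True
    \<comment> \<open>If the newest vertex lies in \<open>B\<close>, the rest of \<open>B\<close> is
      its whole neighbourhood \<open>S\<close>, so no vertex outside \<open>B\<close> is adjacent to
      \<open>v\<close> and all can take the label \<open>v\<close>.\<close>
    have "B - {v} \<subseteq> S" by (rule star_clique_new[OF step.hyps(1-3) True step.prems(3)])
    then have "B - {v} = S"
      using step True fin fB finite_subset[of S V] by (intro card_seteq) auto
    then have "\<forall>u\<in>insert v V - B. {u, v} \<notin> ?E" using new' by blast
    then show ?thesis using True by (intro exI[of _ "\<lambda>_. v"]) blast
  next
    case False
    then have BV: "B \<subseteq> V" using step.prems(1) by blast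
    have "is_clique E B" using star_clique_old[OF step.hyps(1-3) False] step.prems(3) by (rule iffD1)
    from step.IH[OF BV step.prems(2) this]
    obtain f where f: "\<And>u. u \<in> V - B \<Longrightarrow> f u \<in> B \<and> {u, f u} \<notin> E"
      "\<And>u w. u \<in> V - B \<Longrightarrow> w \<in> V - B \<Longrightarrow> {u, w} \<in> E \<Longrightarrow> f u = f w"
      by metis
    \<comment> \<open>\<open>b\<close> will be the label of \<open>v\<close>. The vertices of
      \<open>S - B\<close> are pairwise adjacent and so share a label, which lies outside
      \<open>S\<close> because it is not adjacent to them. If \<open>S\<close> lies inside
      \<open>B\<close>, the vertex of \<open>B\<close> missing from \<open>S\<close> serves.\<close>
    obtain b where b: "b \<in> B" "b \<notin> S" "\<And>s. s \<in> S - B \<Longrightarrow> f s = b"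
    proof (cases "S \<subseteq> B")
      case True
      have "S \<noteq> B" using step.hyps(4) step.prems(2) by auto
      then show thesis using that True by blast
    next
      case False
      then obtain s where s: "s \<in> S - B" by blast
      then have fs: "f s \<in> B" "{s, f s} \<notin> E" using f(1)[of s] step.hyps(3) by auto
      moreover have "s \<noteq> f s" using fs(1) s by (metis DiffD2)
      ultimately have "f s \<notin> S" using is_cliqueD[OF step.hyps(5), of s "f s"] s by blast
      moreover have "f s' = f s" if "s' \<in> S - B" for s'
      proof (cases "s' = s")
        case False
        then have "{s', s} \<in> E" using that s by (intro is_cliqueD[OF step.hyps(5)]) auto
        then show ?thesis using that s step.hyps(3) f(2) by blast
      qed simp
      ultimately show thesis using that[of "f s"] fs by blast
    qed
    let ?f = "f(v := b)"
    have P1: "?f u \<in> B \<and> {u, ?f u} \<notin> ?E" if "u \<in> insert v V - B" for u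
    proof (cases "u = v")
      case True
      then show ?thesis using b new by auto
    next
      case False
      then have "f u \<in> B" "{u, f u} \<notin> E" using f that by auto
      moreover have "f u \<noteq> v" using \<open>f u \<in> B\<close> \<open>v \<notin> B\<close> by blast
      ultimately show ?thesis using old[of u "f u"] False by simp
    qed
    have P2: "?f u = ?f w" if "u \<in> insert v V - B" "w \<in> insert v V - B" "{u, w} \<in> ?E" for u w
    proof (cases "u = v")
      case True
      then have "w \<in> S" using new that by blast
      then show ?thesis using b that True step.hyps(2,3) by auto
    next
      case uv: False
      show ?thesis
      proof (cases "w = v")
        case True
        then have "u \<in> S" using new' that by blast
        then show ?thesis using b that True uv by auto
      next
        case False
        then show ?thesis using old[OF uv False] that uv f(2)[of u w] by simp
      qed
    qed
    show ?thesis
      by (rule exI[of _ ?f], intro conjI ballI impI)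
        ((rule P1[THEN conjunct1] P1[THEN conjunct2] P2; assumption)+)
  qed
qed

text \<open>For a k-clique \<open>C\<close>, roots stand for the (k+1)-cliques containing
  \<open>C\<close>, so their number is the degree of \<open>C\<close>, see
  \<open>clique_degree_roots\<close>.\<close>

definition roots :: "'a set \<Rightarrow> 'a set set \<Rightarrow> 'a set \<Rightarrow> 'a set" where
  "roots V E C = {b \<in> V - C. is_clique E (insert b C)}"

lemma roots_iff: "b \<in> roots V E C \<longleftrightarrow> b \<in> V \<and> b \<notin> C \<and> is_clique E (insert b C)"
  by (simp add: roots_def)

text \<open>The label \<open>g u\<close> names the branch at \<open>C\<close> in which
  \<open>u\<close> lies. As \<open>g\<close> is constant along edges outside \<open>C\<close> and
  fixes the roots, distinct roots lie in different components once \<open>C\<close> is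
  removed.\<close>

lemma root_labelling:
  assumes "ktree k V E" "C \<subseteq> V" "card C = k" "is_clique E C" "k > 0"
  shows "\<exists>g. (\<forall>u\<in>V - C. g u \<in> roots V E C) \<and> (\<forall>u\<in>roots V E C. g u = u) \<and>
             (\<forall>u\<in>V - C. \<forall>w\<in>V - C. {u, w} \<in> E \<longrightarrow> g u = g w)"
  using assms
proof (induction arbitrary: C rule: ktree.induct)
  case (base V)
  then have "C = V" by (simp add: card_seteq)
  then show ?case by (simp add: roots_def)
next
  case (step V E v S)
  let ?E = "E \<union> {{v, s} | s. s \<in> S}"
  note new = star_edge_iff(1)[OF step.hyps(1-3)] and old = star_edge_iff(2)[OF step.hyps(1-3)]
  have new': "{y, v} \<in> ?E \<longleftrightarrow> y \<in> S" for y using new[of y] by (simp only: insert_commute[of y v])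
  have fin: "finite V" using ktree_finite[OF step.hyps(1)] .
  then have fC: "finite C" using step.prems(1) finite_subset by blast
  have fS: "finite S" using step.hyps(3) fin by (rule finite_subset)
  have SE: "is_clique ?E (insert v S)"
    using step.hyps(5) by (rule star_clique_apex)
  show ?case
  proof (cases "v \<in> C")
    case True
    have sub: "C - {v} \<subseteq> S" by (rule star_clique_new[OF step.hyps(1-3) True step.prems(3)])
    have "card (S - (C - {v})) = 1"
      using sub True fC step.prems step.hyps card_Suc_Diff1[OF fC True]
      by (subst card_Diff_subset) (auto simp: card_Diff_singleton)
    then obtain s where s: "S - (C - {v}) = {s}" by (auto simp: card_1_singleton_iff)
    have sC: "s \<notin> C" using s step.hyps(2,3) by blast
    have "insert s C \<subseteq> insert v S" using s sub by blast
    then have "is_clique ?E (insert s C)" using SE is_clique_subset by blast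
    then have "s \<in> roots (insert v V) ?E C" using s sC step.hyps(3) by (simp add: roots_iff) blast
    moreover have "u = s" if "u \<in> roots (insert v V) ?E C" for u
    proof -
      have u: "u \<notin> C" "is_clique ?E (insert u C)" using that unfolding roots_iff by simp_all
      then have "u \<noteq> v" using True by blast
      then have "{u, v} \<in> ?E" using is_cliqueD[OF u(2), of u v] True by simp
      then have "u \<in> S" using new'[of u] by (rule iffD1[rotated])
      then show ?thesis using u(1) s by blast
    qed
    ultimately show ?thesis by (intro exI[of _ "\<lambda>_. s"]) blast
  next
    case False
    then have CV: "C \<subseteq> V" using step.prems(1) by blast
    have "is_clique E C" using star_clique_old[OF step.hyps(1-3) False] step.prems(3) by (rule iffD1)
    from step.IH[OF CV step.prems(2) this step.prems(4)]
    obtain g where g: "\<And>u. u \<in> V - C \<Longrightarrow> g u \<in> roots V E C"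
      "\<And>u. u \<in> roots V E C \<Longrightarrow> g u = u"
      "\<And>u w. u \<in> V - C \<Longrightarrow> w \<in> V - C \<Longrightarrow> {u, w} \<in> E \<Longrightarrow> g u = g w"
      by metis
    have ro: "u \<in> roots (insert v V) ?E C \<longleftrightarrow> u \<in> roots V E C" if "u \<noteq> v" for u
      using star_clique_old[OF step.hyps(1-3), of "insert u C"] that False by (simp add: roots_iff)
    have rv: "v \<in> roots (insert v V) ?E C \<longleftrightarrow> S = C"
    proof
      assume "v \<in> roots (insert v V) ?E C"
      then have "C \<subseteq> S" using star_clique_new[OF step.hyps(1-3), of "insert v C"] False
        by (auto simp: roots_iff)
      then show "S = C" using card_seteq[OF fS, of C] step.hyps(4) step.prems(2) by simp
    next
      assume "S = C"
      then show "v \<in> roots (insert v V) ?E C" using False SE by (simp add: roots_iff)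
    qed
    \<comment> \<open>The label of the new vertex is \<open>v\<close> itself if it is attached to
      \<open>C\<close>, otherwise the common label of the pairwise adjacent vertices of
      \<open>S - C\<close>.\<close>
    obtain r where r: "r \<in> roots (insert v V) ?E C" "\<And>s. s \<in> S - C \<Longrightarrow> g s = r" "S = C \<Longrightarrow> r = v"
    proof (cases "S = C")
      case True
      then show thesis using that rv by blast
    next
      case False
      then have "\<not> S \<subseteq> C" using card_seteq[OF fC] step.hyps(4) step.prems(2) by auto
      then obtain s where s: "s \<in> S - C" by blast
      have "g s' = g s" if "s' \<in> S - C" for s'
      proof (cases "s' = s")
        case False
        then have "{s', s} \<in> E" using that s by (intro is_cliqueD[OF step.hyps(5)]) auto
        then show ?thesis using that s step.hyps(3) g(3) by blast
      qed simp
      moreover have "g s \<in> roots V E C" using g(1) s step.hyps(3) by blast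
      moreover have "g s \<noteq> v" using \<open>g s \<in> roots V E C\<close> step.hyps(2) unfolding roots_def by blast
      ultimately show thesis using that ro False by blast
    qed
    let ?g = "g(v := r)"
    have P1: "?g u \<in> roots (insert v V) ?E C" if "u \<in> insert v V - C" for u
    proof (cases "u = v")
      case False
      then have "g u \<in> roots V E C" using g that by blast
      then have "g u \<noteq> v" using step.hyps(2) unfolding roots_def by blast
      then show ?thesis using ro \<open>g u \<in> roots V E C\<close> False by simp
    qed (use r in simp)
    have P2: "?g u = u" if "u \<in> roots (insert v V) ?E C" for u
      using that ro rv r(3) g(2) by (cases "u = v") auto
    have P3: "?g u = ?g w" if "u \<in> insert v V - C" "w \<in> insert v V - C" "{u, w} \<in> ?E" for u w
    proof (cases "u = v")
      case True
      then have "w \<in> S" using new that by blast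
      then show ?thesis using r(2) that True step.hyps(2,3) by auto
    next
      case uv: False
      show ?thesis
      proof (cases "w = v")
        case True
        then have "u \<in> S" using new' that by blast
        then show ?thesis using r(2) that True uv by auto
      next
        case False
        then show ?thesis using old[OF uv False] that uv g(3)[of u w] by simp
      qed
    qed
    show ?thesis
      by (rule exI[of _ ?g], intro conjI ballI impI) ((rule P1 P2 P3; assumption)+)
  qed
qed

section \<open>Mean excess of accessible families\<close>

definition excess :: "'a set \<Rightarrow> 'a set set \<Rightarrow> nat" where
  "excess K H = (\<Sum>X\<in>H. card (X - K))"

definition mean :: "'a set \<Rightarrow> 'a set set \<Rightarrow> real" where
  "mean K H = real (excess K H) / real (card H)"

definition labelled :: "nat \<Rightarrow> 'a set set \<Rightarrow> 'a set \<Rightarrow> ('a \<Rightarrow> 'b) \<Rightarrow> 'b set \<Rightarrow> 'a set set" where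
  "labelled k E K f D = {X. grow k E K X \<and> (\<forall>x\<in>X - K. f x \<in> D)}"

text \<open>Every set \<^term>\<open>X\<close> of an accessible family sits on top of a chain of
  \<^term>\<open>card (X - K)\<close> smaller members, so the excesses count distinct pairs of members.\<close>

lemma accessible_below:
  assumes "finite H" "\<And>X. X \<in> H \<Longrightarrow> finite X"
    and acc: "\<And>X. X \<in> H \<Longrightarrow> X - K \<noteq> {} \<Longrightarrow> \<exists>x\<in>X - K. X - {x} \<in> H"
    and "X \<in> H"
  shows "card (X - K) \<le> card {Y \<in> H. card (Y - K) < card (X - K)}"
  using assms(4)
proof (induction "card (X - K)" arbitrary: X)
  case (Suc n)
  then have "X - K \<noteq> {}" by (metis card.empty nat.distinct(1))
  then obtain x where x: "x \<in> X - K" "X - {x} \<in> H" using acc Suc.prems by blast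
  have "X - {x} - K = (X - K) - {x}" by blast
  then have c: "card (X - {x} - K) = n"
    using Suc.hyps(2) x assms(2)[OF Suc.prems] by simp
  let ?L = "\<lambda>X. {Y \<in> H. card (Y - K) < card (X - K)}"
  have "insert (X - {x}) (?L (X - {x})) \<subseteq> ?L X" using x c Suc.hyps(2) by auto
  then have "card (insert (X - {x}) (?L (X - {x}))) \<le> card (?L X)"
    using assms(1) by (intro card_mono) auto
  moreover have "card (insert (X - {x}) (?L (X - {x}))) = Suc (card (?L (X - {x})))"
    using assms(1) by (subst card_insert_disjoint) auto
  ultimately show ?case using Suc.hyps(1)[of "X - {x}"] x c Suc.hyps(2) by simp
qed simp

lemma accessible_excess_le:
  assumes "finite H" "\<And>X. X \<in> H \<Longrightarrow> finite X"
    and acc: "\<And>X. X \<in> H \<Longrightarrow> X - K \<noteq> {} \<Longrightarrow> \<exists>x\<in>X - K. X - {x} \<in> H"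
  shows "2 * excess K H + card H \<le> card H * card H"
proof -
  let ?L = "SIGMA X:H. {Y \<in> H. card (Y - K) < card (X - K)}"
  have "excess K H \<le> (\<Sum>X\<in>H. card {Y \<in> H. card (Y - K) < card (X - K)})"
    unfolding excess_def using accessible_below[OF assms] by (rule sum_mono)
  also have "\<dots> = card ?L" using assms(1) by (subst card_SigmaI) auto
  finally have e: "excess K H \<le> card ?L" .
  have fin: "finite ?L" using assms(1) by auto
  \<comment> \<open>The pairs of members with decreasing excess, their converses and the diagonal
    are disjoint; this gives the factor 2 and the extra \<open>card H\<close>.\<close>
  have "?L \<union> ?L\<inverse> \<union> Id_on H \<subseteq> H \<times> H" by auto
  then have "card (?L \<union> ?L\<inverse> \<union> Id_on H) \<le> card (H \<times> H)"
    using assms(1) by (intro card_mono) auto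
  then have "card (?L \<union> ?L\<inverse> \<union> Id_on H) \<le> card H * card H"
    by (simp only: card_cartesian_product)
  moreover have "card (?L \<union> ?L\<inverse> \<union> Id_on H) = card (?L \<union> ?L\<inverse>) + card (Id_on H)"
    using fin assms(1) by (intro card_Un_disjoint) (auto simp: Id_on_def)
  moreover have "card (?L \<union> ?L\<inverse>) = card ?L + card (?L\<inverse>)"
    using fin by (intro card_Un_disjoint) auto
  moreover have "card (Id_on H) = card H"
  proof -
    have "Id_on H = (\<lambda>x. (x, x)) ` H" by (auto simp: Id_on_def)
    then show ?thesis by (simp add: card_image inj_on_def)
  qed
  ultimately show ?thesis using e by simp
qed

text \<open>Dividing the pair count by \<open>card H\<close> gives the bound
  \<open>N \<ge> 1 + 2 m\<close> on which the later comparisons rest.\<close>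

lemma accessible_mean_le:
  assumes "finite H" "\<And>X. X \<in> H \<Longrightarrow> finite X" "H \<noteq> {}"
    and acc: "\<And>X. X \<in> H \<Longrightarrow> X - K \<noteq> {} \<Longrightarrow> \<exists>x\<in>X - K. X - {x} \<in> H"
  shows "1 + 2 * mean K H \<le> real (card H)"
proof -
  have pos: "real (card H) > 0" using assms(1,3) by (simp add: card_gt_0_iff)
  have "real (2 * excess K H + card H) \<le> real (card H * card H)"
    using accessible_excess_le[of H K] assms by (intro of_nat_mono) blast
  then have "(2 * real (excess K H) + real (card H)) / real (card H) \<le> real (card H)"
    using pos by (simp add: divide_le_eq)
  then show ?thesis using pos by (simp add: mean_def add_divide_distrib)
qed

text \<open>Members other than \<open>K\<close> have positive excess, and in a family of at least
  two they make up at least half.\<close>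

lemma mean_ge_half:
  assumes "finite H" "\<And>X. X \<in> H \<Longrightarrow> finite X \<and> K \<subseteq> X" "card H \<ge> 2"
  shows "mean K H \<ge> 1 / 2"
proof -
  have "card H - 1 \<le> card (H - {K})" using assms(1) by (simp add: card_Diff_singleton_if)
  also have "\<dots> = (\<Sum>X\<in>H - {K}. 1)" by simp
  also have "\<dots> \<le> (\<Sum>X\<in>H - {K}. card (X - K))"
  proof (rule sum_mono)
    fix X assume "X \<in> H - {K}"
    then have "X - K \<noteq> {}" "finite (X - K)" using assms(2) by auto
    then show "1 \<le> card (X - K)" by (simp add: Suc_le_eq card_gt_0_iff)
  qed
  also have "\<dots> \<le> excess K H" unfolding excess_def using assms(1) by (intro sum_mono2) auto
  finally have "card H \<le> 2 * excess K H" using assms(3) by simp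
  then have "real (card H) \<le> 2 * real (excess K H)" by (metis of_nat_le_iff of_nat_mult of_nat_numeral)
  then show ?thesis using assms(3) by (simp add: mean_def field_simps)
qed

lemma grow_accessible:
  assumes "grow k E K X" "X - K \<noteq> {}"
  shows "\<exists>x\<in>X - K. grow k E K (X - {x})"
  using assms
proof induction
  case (add X S v)
  show ?case
  proof (cases "v \<in> X")
    case True
    then show ?thesis using add by (simp add: insert_absorb)
  next
    case False
    then show ?thesis using add grow_superset[OF add.hyps(1)] by (intro bexI[of _ v]) auto
  qed
qed simp

section \<open>Families over independent parts multiply\<close>

locale ktree_graph =
  fixes k :: nat and V :: "'a set" and E :: "'a set set"
  assumes k2: "k \<ge> 2" and ktree: "ktree k V E"
begin

lemma finite_V: "finite V"
  using ktree by (rule ktree_finite)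

lemma grow_subset: "grow k E K X \<Longrightarrow> K \<subseteq> V \<Longrightarrow> X \<subseteq> V"
proof (induction rule: grow.induct)
  case (add X S v)
  \<comment> \<open>Since \<open>v\<close> may lie in \<open>S\<close>, two elements of
    \<open>S\<close> are needed to find an edge at \<open>v\<close>; this uses
    \<open>k2\<close>.\<close>
  have "S \<noteq> {v}" "S \<noteq> {}" using add.hyps(3) k2 by auto
  then obtain s where "s \<in> S" "s \<noteq> v" by blast
  then have "{v, s} \<in> E" by (intro is_cliqueD[OF add.hyps(4)]) auto
  then show ?case using add ktree_edge_vertex[OF ktree] by blast
qed

lemma grow_finite: "grow k E K X \<Longrightarrow> K \<subseteq> V \<Longrightarrow> finite X"
  by (rule finite_subset[OF grow_subset finite_V])

lemma finite_family:
  assumes "K \<subseteq> V" shows "finite {X. grow k E K X \<and> P X}"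
  by (rule finite_subset[of _ "Pow V"]) (use grow_subset assms finite_V in auto)

text \<open>Closure of \<open>P\<close> under deletion makes the family accessible, and
  \<open>P K\<close> makes it nonempty. Applied to sets avoiding a vertex and to sets with
  restricted roots.\<close>

lemma family_bounds:
  assumes "K \<subseteq> V" "P K" "\<And>X x. P X \<Longrightarrow> P (X - {x})"
  shows "1 + 2 * mean K {X. grow k E K X \<and> P X} \<le> real (card {X. grow k E K X \<and> P X})"
    and "card {X. grow k E K X \<and> P X} \<ge> 2 \<Longrightarrow> mean K {X. grow k E K X \<and> P X} \<ge> 1 / 2"
    and "mean K {X. grow k E K X \<and> P X} \<ge> 0"
proof -
  show "1 + 2 * mean K {X. grow k E K X \<and> P X} \<le> real (card {X. grow k E K X \<and> P X})"
  proof (rule accessible_mean_le)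
    show "finite {X. grow k E K X \<and> P X}" using finite_family assms by blast
    show "{X. grow k E K X \<and> P X} \<noteq> {}" using assms grow.start by blast
  qed (use grow_finite grow_accessible assms in blast)+
  show "card {X. grow k E K X \<and> P X} \<ge> 2 \<Longrightarrow> mean K {X. grow k E K X \<and> P X} \<ge> 1 / 2"
  proof (rule mean_ge_half)
    fix X assume "X \<in> {X. grow k E K X \<and> P X}"
    then show "finite X \<and> K \<subseteq> X" using grow_finite[OF _ assms(1)] grow_superset by blast
  qed (use finite_family assms(1) in blast)+
  show "mean K {X. grow k E K X \<and> P X} \<ge> 0" by (simp add: mean_def)
qed

text \<open>A newly attached \<open>v\<close> is adjacent to all of its clique \<open>S\<close>, so
  vertices of \<open>S\<close> outside \<open>K\<close> carry the label of \<open>v\<close>. Hence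
  the steps with labels in \<open>D\<close> form a growth of their own.\<close>

lemma grow_restrict:
  assumes "K \<subseteq> V" and f: "\<And>u w. u \<in> V - K \<Longrightarrow> w \<in> V - K \<Longrightarrow> {u, w} \<in> E \<Longrightarrow> f u = f w"
    and "grow k E K X"
  shows "grow k E K {x \<in> X. x \<in> K \<or> f x \<in> D}"
  using assms(3)
proof induction
  case start
  have "{x \<in> K. x \<in> K \<or> f x \<in> D} = K" by blast
  then show ?case using grow.start[of k E K] by simp
next
  case (add X S v)
  note XV = grow_subset[OF add.hyps(1) assms(1)]
  have "insert v X \<subseteq> V" using grow_subset[OF grow.add[OF add.hyps] assms(1)] .
  then have v: "v \<in> V" by blast
  show ?case
  proof (cases "v \<notin> X \<and> f v \<in> D")
    case True
    then have "v \<notin> K" using grow_superset[OF add.hyps(1)] by blast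
    have "s \<in> K \<or> f s \<in> D" if "s \<in> S" for s
    proof (cases "s \<in> K")
      case False
      have "{v, s} \<in> E" using that True add.hyps(2) by (intro is_cliqueD[OF add.hyps(4)]) auto
      then have "f v = f s" using f[of v s] v \<open>v \<notin> K\<close> that False add.hyps(2) XV by blast
      then show ?thesis using True by simp
    qed simp
    then have "S \<subseteq> {x \<in> X. x \<in> K \<or> f x \<in> D}" using add.hyps(2) by blast
    then have "grow k E K (insert v {x \<in> X. x \<in> K \<or> f x \<in> D})"
      using add.hyps by (intro grow.add[OF add.IH])
    moreover have "insert v {x \<in> X. x \<in> K \<or> f x \<in> D} = {x \<in> insert v X. x \<in> K \<or> f x \<in> D}"
      using True by blast
    ultimately show ?thesis by simp
  next
    case False
    then have "{x \<in> insert v X. x \<in> K \<or> f x \<in> D} = {x \<in> X. x \<in> K \<or> f x \<in> D}"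
      using grow_superset[OF add.hyps(1)] by blast
    then show ?thesis using add.IH by simp
  qed
qed

text \<open>Union is a bijection from pairs of sets with labels in \<open>D1\<close> and in
  \<open>D2\<close>; its inverse is restriction, by \<open>grow_restrict\<close>. The second
  equation becomes additivity of means after division by the cardinalities.\<close>

lemma labelled_Un:
  assumes K: "K \<subseteq> V" and f: "\<And>u w. u \<in> V - K \<Longrightarrow> w \<in> V - K \<Longrightarrow> {u, w} \<in> E \<Longrightarrow> f u = f w"
    and D: "D1 \<inter> D2 = {}"
  shows "card (labelled k E K f (D1 \<union> D2)) = card (labelled k E K f D1) * card (labelled k E K f D2)"
    and "excess K (labelled k E K f (D1 \<union> D2)) =
      excess K (labelled k E K f D1) * card (labelled k E K f D2)
      + card (labelled k E K f D1) * excess K (labelled k E K f D2)"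
proof -
  let ?L = "labelled k E K f"
  have fin: "finite (?L D)" for D unfolding labelled_def using finite_family[OF K] .
  have sup: "K \<subseteq> X \<and> finite X" if "X \<in> ?L D" for X D
    using that grow_superset grow_finite[OF _ K] unfolding labelled_def by blast
  have bij: "bij_betw (\<lambda>(X, Y). X \<union> Y) (?L D1 \<times> ?L D2) (?L (D1 \<union> D2))"
  proof (rule bij_betw_byWitness[where f' = "\<lambda>X. ({x \<in> X. x \<in> K \<or> f x \<in> D1}, {x \<in> X. x \<in> K \<or> f x \<in> D2})"])
    show "\<forall>p\<in>?L D1 \<times> ?L D2. (\<lambda>X. ({x \<in> X. x \<in> K \<or> f x \<in> D1}, {x \<in> X. x \<in> K \<or> f x \<in> D2}))
        ((\<lambda>(X, Y). X \<union> Y) p) = p"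
    proof
      fix p assume "p \<in> ?L D1 \<times> ?L D2"
      then obtain X Y where p: "p = (X, Y)" "X \<in> ?L D1" "Y \<in> ?L D2" by blast
      have "K \<subseteq> X" "K \<subseteq> Y" using sup p by blast+
      moreover have "f x \<in> D1" if "x \<in> X - K" for x using p that unfolding labelled_def by blast
      moreover have "f x \<in> D2" if "x \<in> Y - K" for x using p that unfolding labelled_def by blast
      ultimately have "{x \<in> X \<union> Y. x \<in> K \<or> f x \<in> D1} = X" "{x \<in> X \<union> Y. x \<in> K \<or> f x \<in> D2} = Y"
        using D by blast+
      then show "(\<lambda>X. ({x \<in> X. x \<in> K \<or> f x \<in> D1}, {x \<in> X. x \<in> K \<or> f x \<in> D2}))
        ((\<lambda>(X, Y). X \<union> Y) p) = p" using p by simp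
    qed
    show "\<forall>X\<in>?L (D1 \<union> D2). (\<lambda>(X, Y). X \<union> Y)
        ({x \<in> X. x \<in> K \<or> f x \<in> D1}, {x \<in> X. x \<in> K \<or> f x \<in> D2}) = X"
      unfolding labelled_def by auto
    show "(\<lambda>(X, Y). X \<union> Y) ` (?L D1 \<times> ?L D2) \<subseteq> ?L (D1 \<union> D2)"
    proof clarify
      fix X Y assume XY: "X \<in> ?L D1" "Y \<in> ?L D2"
      then have "grow k E K X" "grow k E K Y" "K \<subseteq> Y" using sup unfolding labelled_def by blast+
      then have "grow k E K (X \<union> Y)" by (rule grow_Un)
      then show "X \<union> Y \<in> ?L (D1 \<union> D2)" using XY unfolding labelled_def by blast
    qed
    show "(\<lambda>X. ({x \<in> X. x \<in> K \<or> f x \<in> D1}, {x \<in> X. x \<in> K \<or> f x \<in> D2})) ` ?L (D1 \<union> D2)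
        \<subseteq> ?L D1 \<times> ?L D2"
      using grow_restrict[OF K f] unfolding labelled_def by auto
  qed
  show "card (?L (D1 \<union> D2)) = card (?L D1) * card (?L D2)"
    using bij_betw_same_card[OF bij] by (simp add: card_cartesian_product)
  have "excess K (?L (D1 \<union> D2)) = (\<Sum>(X, Y)\<in>?L D1 \<times> ?L D2. card (X \<union> Y - K))"
    unfolding excess_def using sum.reindex_bij_betw[OF bij, of "\<lambda>X. card (X - K)"]
    by (simp add: case_prod_beta)
  also have "\<dots> = (\<Sum>(X, Y)\<in>?L D1 \<times> ?L D2. card (X - K) + card (Y - K))"
  proof (rule sum.cong[OF refl], clarify)
    fix X Y assume XY: "X \<in> ?L D1" "Y \<in> ?L D2"
    have "(X - K) \<inter> (Y - K) = {}" using XY D unfolding labelled_def by blast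
    moreover have "X \<union> Y - K = (X - K) \<union> (Y - K)" by blast
    ultimately show "card (X \<union> Y - K) = card (X - K) + card (Y - K)"
      using sup XY by (simp add: card_Un_disjoint)
  qed
  also have "\<dots> = (\<Sum>X\<in>?L D1. \<Sum>Y\<in>?L D2. card (X - K) + card (Y - K))"
    by (rule sum.cartesian_product[symmetric])
  also have "\<dots> = excess K (?L D1) * card (?L D2) + card (?L D1) * excess K (?L D2)"
    by (simp add: sum.distrib excess_def sum_distrib_left mult.commute)
  finally show "excess K (?L (D1 \<union> D2)) =
      excess K (?L D1) * card (?L D2) + card (?L D1) * excess K (?L D2)" .
qed

lemma labelled_prod:
  assumes K: "K \<subseteq> V" and f: "\<And>u w. u \<in> V - K \<Longrightarrow> w \<in> V - K \<Longrightarrow> {u, w} \<in> E \<Longrightarrow> f u = f w"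
    and "finite D"
  shows "card (labelled k E K f D) = (\<Prod>d\<in>D. card (labelled k E K f {d})) \<and>
    mean K (labelled k E K f D) = (\<Sum>d\<in>D. mean K (labelled k E K f {d}))"
  using assms(3)
proof induction
  case empty
  have "X = K" if "X \<in> labelled k E K f {}" for X
    using that grow_superset unfolding labelled_def by blast
  then have "labelled k E K f {} = {K}" unfolding labelled_def using grow.start by blast
  then show ?case by (simp add: mean_def excess_def)
next
  case (insert d D)
  let ?L = "labelled k E K f"
  have "card (?L D) > 0" for D
    using finite_family[OF K] grow.start unfolding labelled_def by (fastforce simp: card_gt_0_iff)
  then have pos: "real (card (?L D)) \<noteq> 0" for D by (metis less_irrefl of_nat_eq_0_iff)
  have eq: "?L (insert d D) = ?L ({d} \<union> D)" by simp
  have D: "{d} \<inter> D = {}" using insert by blast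
  have c: "card (?L (insert d D)) = card (?L {d}) * card (?L D)"
    unfolding eq by (rule labelled_Un(1)[OF K f D])
  have e: "excess K (?L (insert d D))
      = excess K (?L {d}) * card (?L D) + card (?L {d}) * excess K (?L D)"
    unfolding eq by (rule labelled_Un(2)[OF K f D])
  have "mean K (?L (insert d D)) = mean K (?L {d}) + mean K (?L D)"
    unfolding mean_def c e using pos[of D] pos[of "{d}"] by (simp add: field_simps)
  then show ?case using insert c by simp
qed

end

text \<open>These sets describe what lies behind the facet \<open>B - {b}\<close>, seen from
  \<open>B\<close>. Forbidding \<open>b\<close> alone suffices for this, as
  \<open>side_labelled\<close> shows.\<close>

definition side :: "nat \<Rightarrow> 'a set set \<Rightarrow> 'a set \<Rightarrow> 'a \<Rightarrow> 'a set set" where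
  "side k E B b = {X. grow k E (B - {b}) X \<and> b \<notin> X}"

section \<open>Inequalities for real weights\<close>

text \<open>The weights are real numbers: \<open>N\<close> counts the members of a family and \<open>m\<close> is its mean
  excess; index \<open>0\<close> refers to the part of the graph behind the clique we walk away from, index
  \<open>i\<close> to the part behind the neighbouring clique, and \<open>Q\<close>, \<open>x\<close> to all remaining parts.\<close>

lemma mean_increase:
  fixes N0 m0 Ni mi Q x :: real
  defines "M \<equiv> Ni * Q" and "A \<equiv> mi + x"
  assumes N0: "N0 \<ge> 1" "m0 \<ge> 0" and Ni: "Ni \<ge> 2" "mi \<ge> 1 / 2"
    and Q: "Q \<ge> 1 + 2 * x" "x \<ge> 0" and Q': "Q \<ge> 3 \<or> Q = 2 \<and> Ni = 2"
    and key: "(1 + M) * (1 + m0) \<le> N0 * (1 + M * (1 + A) / (1 + M))"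
  shows "(N0 * m0 + N0 * M * (1 + m0 + A)) / (N0 + N0 * M)
    < (Ni * mi + N0 * M * (1 + m0 + A)) / (Ni + N0 * M)"
proof -
  have Q2: "Q \<ge> 2" using Q' by auto
  have M0: "M > 0" unfolding M_def using Ni Q2 by simp
  have A0: "A \<ge> 1 / 2" unfolding A_def using Ni Q by simp
  \<comment> \<open>\<open>D\<close> is \<open>1 + M\<close> times the last factor of
    \<open>key\<close>, so that \<open>key'\<close> is free of fractions.\<close>
  define D where "D = 1 + 2 * M + M * A"
  have D0: "D > 0" unfolding D_def using M0 A0 by (simp add: add_pos_nonneg)
  have "(1 + M) * (1 + M) * (1 + m0) = (1 + M) * ((1 + M) * (1 + m0))" by simp
  also have "\<dots> \<le> (1 + M) * (N0 * (1 + M * (1 + A) / (1 + M)))"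
    using key M0 by (intro mult_left_mono) auto
  also have "\<dots> = N0 * D" unfolding D_def using M0 by (simp add: field_simps)
  finally have key': "(1 + M) * (1 + M) * (1 + m0) \<le> N0 * D" .
  \<comment> \<open>The aim is \<open>M * (1 + x) + (1 + M) * m0 \<le> Q * N0 * (1 + A)\<close>.
    After multiplication by \<open>D\<close>, \<open>I1\<close> takes care of the coefficient of
    \<open>m0\<close> and \<open>I2\<close> of the rest; then \<open>key'\<close> applies.\<close>
  have I1: "D \<le> Q * (1 + M) * (1 + A)"
  proof -
    have "D \<le> 2 * ((1 + M) * (1 + A))"
      unfolding D_def using M0 A0 by (simp add: algebra_simps)
    also have "\<dots> \<le> Q * ((1 + M) * (1 + A))" using Q2 M0 A0 by (intro mult_right_mono) auto
    finally show ?thesis by (simp add: mult.assoc)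
  qed
  have I2: "M * (1 + x) * D \<le> Q * (1 + M) * (1 + M) * (1 + A)"
    using Q'
  proof
    assume Q3: "Q \<ge> 3"
    have J: "(1 + x) * (2 + A) \<le> Q * (1 + A)"
    proof (cases "x \<ge> 1")
      case True
      have "(1 + 2 * x) * (1 + A) - (1 + x) * (2 + A)
          = x * (x - 1) + x * (mi - 1 / 2) + 3 / 2 * x - 1"
        unfolding A_def by (simp add: algebra_simps)
      moreover have "0 \<le> x * (x - 1)" "0 \<le> x * (mi - 1 / 2)" using True Ni by simp_all
      ultimately have "(1 + x) * (2 + A) \<le> (1 + 2 * x) * (1 + A)" using True by linarith
      also have "\<dots> \<le> Q * (1 + A)" using Q A0 by (intro mult_right_mono) auto
      finally show ?thesis .
    next
      case False
      have "x * A \<le> 1 * A" using False A0 by (intro mult_right_mono) auto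
      then have "(1 + x) * (2 + A) \<le> 3 * (1 + A)"
        using False Ni Q unfolding A_def by (simp add: algebra_simps)
      also have "\<dots> \<le> Q * (1 + A)" using Q3 A0 by (intro mult_right_mono) auto
      finally show ?thesis .
    qed
    have "D \<le> (1 + M) * (2 + A)" unfolding D_def using A0 M0 by (simp add: algebra_simps)
    then have "M * (1 + x) * D \<le> (1 + M) * (1 + x) * ((1 + M) * (2 + A))"
      using M0 Q D0 by (intro mult_mono) auto
    also have "\<dots> = (1 + M) * (1 + M) * ((1 + x) * (2 + A))" by (simp add: algebra_simps)
    also have "\<dots> \<le> (1 + M) * (1 + M) * (Q * (1 + A))"
      using J M0 by (intro mult_left_mono) auto
    finally show ?thesis by (simp add: algebra_simps)
  next
    assume QN: "Q = 2 \<and> Ni = 2"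
    \<comment> \<open>The estimate \<open>J\<close> can fail for \<open>Q = 2\<close>, but now
      \<open>x \<le> 1/2\<close> and \<open>D = 9 + 4 * A\<close> are known.\<close>
    then have M4: "M = 4" unfolding M_def by simp
    have "(1 + x) * (9 + 4 * A) \<le> (3 / 2) * (9 + 4 * A)"
      using QN Q A0 by (intro mult_right_mono) auto
    then show ?thesis unfolding D_def M4 using QN A0 by (simp add: algebra_simps)
  qed
  have Ni0: "Ni + N0 * M > 0" "N0 + N0 * M > 0" using Ni N0 M0 by (simp_all add: add_pos_pos)
  have "D * (M * (1 + x) + (1 + M) * m0) = M * (1 + x) * D + (1 + M) * D * m0"
    by (simp add: algebra_simps)
  also have "\<dots> \<le> Q * (1 + M) * (1 + M) * (1 + A) + (1 + M) * (Q * (1 + M) * (1 + A)) * m0"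
    using I1 I2 M0 N0 by (intro add_mono mult_right_mono mult_left_mono) auto
  also have "\<dots> = Q * (1 + A) * ((1 + M) * (1 + M) * (1 + m0))" by (simp add: algebra_simps)
  also have "\<dots> \<le> Q * (1 + A) * (N0 * D)" using key' Q2 A0 by (intro mult_left_mono) auto
  also have "\<dots> = D * (Q * N0 * (1 + A))" by (simp add: algebra_simps)
  finally have "M * (1 + x) + (1 + M) * m0 \<le> Q * N0 * (1 + A)" using D0 by simp
  then have "0 < (mi - m0) + Q * (N0 * (1 + A) - Ni * (1 + m0 + x))"
    unfolding M_def using Ni by (simp add: algebra_simps)
  then have "0 < N0 * Ni * ((mi - m0) + Q * (N0 * (1 + A) - Ni * (1 + m0 + x)))"
    using N0 Ni by simp
  also have "\<dots> = (Ni * mi + N0 * M * (1 + m0 + A)) * (N0 + N0 * M)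
      - (N0 * m0 + N0 * M * (1 + m0 + A)) * (Ni + N0 * M)"
    unfolding M_def A_def by (simp add: algebra_simps)
  finally show ?thesis using Ni0 by (simp add: divide_less_eq less_divide_eq mult.commute)
qed

text \<open>The right side of \<open>le\<close> is the mean at a clique, the left side that at a
  neighbouring facet with nothing behind it, of weight 1 and mean 0. Cross multiplication and
  dropping a term with \<open>A\<close> leave \<open>M * (N0 - 1 - m0) \<le> m0\<close>, which the
  bounds on \<open>N0\<close> and \<open>M\<close> allow only with equality.\<close>

lemma leaf_comparison:
  fixes N0 m0 M A :: real
  assumes N0: "N0 \<ge> 1 + 2 * m0" "m0 \<ge> 1 / 2" and M: "M \<ge> 1" "A \<ge> 0"
    and le: "N0 * M * (1 + m0 + A) / (1 + N0 * M)
      \<le> (N0 * m0 + N0 * M * (1 + m0 + A)) / (N0 + N0 * M)"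
  shows "M = 1 \<and> N0 = 1 + 2 * m0"
proof -
  have pos: "N0 * M > 0" using N0 M by simp
  have "N0 * M * (1 + m0 + A) * (N0 + N0 * M) \<le> (N0 * m0 + N0 * M * (1 + m0 + A)) * (1 + N0 * M)"
    using le pos N0 by (simp add: divide_le_eq le_divide_eq mult.commute)
  then have "N0 * (M * (1 + m0 + A) * (N0 - 1)) \<le> N0 * (m0 * (1 + N0 * M))"
    by (simp add: algebra_simps)
  then have 1: "M * (1 + m0 + A) * (N0 - 1) \<le> m0 * (1 + N0 * M)" using N0 by simp
  have "0 \<le> M * (A * (N0 - 1))" using M N0 by simp
  then have 2: "M * (N0 - 1 - m0) \<le> m0" using 1 by (simp add: algebra_simps)
  have "1 * (N0 - 1 - m0) \<le> M * (N0 - 1 - m0)" using M N0 by (intro mult_right_mono) auto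
  then have "N0 - 1 - m0 \<le> m0" using 2 by simp
  then have N: "N0 = 1 + 2 * m0" using N0 by simp
  then have "M * m0 \<le> m0" using 2 by simp
  then have "M \<le> 1" using N0 by simp
  then show ?thesis using N M by simp
qed

text \<open>The bound \<open>N \<ge> 1 + 2 m\<close> survives multiplying weights and adding means,
  as multiplying out only creates nonnegative cross terms.\<close>

lemma prod_ge_sum:
  fixes N m :: "'b \<Rightarrow> real"
  assumes "finite I" "\<And>i. i \<in> I \<Longrightarrow> m i \<ge> 0 \<and> N i \<ge> 1 + 2 * m i"
  shows "prod N I \<ge> 1 + 2 * sum m I"
  using assms
proof induction
  case (insert i I)
  have "0 \<le> m i * sum m I" using insert.prems by (intro mult_nonneg_nonneg sum_nonneg) auto
  then have "1 + 2 * (m i + sum m I) \<le> (1 + 2 * m i) * (1 + 2 * sum m I)"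
    by (simp add: algebra_simps)
  also have "\<dots> \<le> N i * prod N I"
  proof (rule mult_mono)
    show "0 \<le> 1 + 2 * sum m I" using insert.prems by (simp add: add_nonneg_nonneg sum_nonneg)
    have "m i \<ge> 0 \<and> N i \<ge> 1 + 2 * m i" using insert.prems by blast
    then show "0 \<le> N i" "1 + 2 * m i \<le> N i" by linarith+
  qed (use insert.IH insert.prems in blast)
  finally show ?case using insert by simp
qed simp

text \<open>The cross term of \<open>m i\<close> and \<open>m j\<close> is positive. Conversely,
  equality leaves at most one index with positive mean, which is how it is used.\<close>

lemma prod_gt_sum:
  fixes N m :: "'b \<Rightarrow> real"
  assumes "finite I" "\<And>i. i \<in> I \<Longrightarrow> m i \<ge> 0 \<and> N i \<ge> 1 + 2 * m i"
    and ij: "i \<in> I" "j \<in> I" "i \<noteq> j" "m i > 0" "m j > 0"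
  shows "prod N I > 1 + 2 * sum m I"
proof -
  let ?J = "I - {i}"
  have J: "prod N ?J \<ge> 1 + 2 * sum m ?J" using assms by (intro prod_ge_sum) auto
  have "sum m ?J \<ge> m j" using assms by (intro member_le_sum) auto
  then have pos: "0 < m i * sum m ?J" using ij by simp
  have "(1 + 2 * m i) * (1 + 2 * sum m ?J) \<le> N i * prod N ?J"
    using J assms(2)[OF ij(1)] \<open>sum m ?J \<ge> m j\<close> ij by (intro mult_mono) auto
  then show ?thesis using pos assms(1) ij(1)
    by (simp add: prod.remove sum.remove algebra_simps)
qed

section \<open>Facets of a (k+1)-clique\<close>

context ktree_graph
begin

lemma fam_finite_card:
  assumes "K \<subseteq> V" "P K" shows "card {X. grow k E K X \<and> P X} > 0"
  using finite_family[OF assms(1), of P] grow.start[of k E K] assms(2) by (auto simp: card_gt_0_iff)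

lemma side_bounds:
  assumes "B \<subseteq> V"
  shows "1 + 2 * mean (B - {b}) (side k E B b) \<le> real (card (side k E B b))"
    and "card (side k E B b) \<ge> 2 \<Longrightarrow> mean (B - {b}) (side k E B b) \<ge> 1 / 2"
    and "mean (B - {b}) (side k E B b) \<ge> 0"
  using family_bounds[of "B - {b}" "\<lambda>X. b \<notin> X"] assms unfolding side_def by auto

lemma grow_facet_iff:
  assumes B: "card B = k + 1" "is_clique E B" and b: "b \<in> B"
  shows "grow k E (B - {b}) X \<and> b \<in> X \<longleftrightarrow> grow k E B X"
proof -
  have Bb: "insert b (B - {b}) = B" "card (B - {b}) = k" using b B by auto
  have gB: "grow k E (B - {b}) B"
    using grow.add[OF grow.start, of "B - {b}" "B - {b}" k E b] Bb B by simp
  show ?thesis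
  proof
    assume *: "grow k E (B - {b}) X \<and> b \<in> X"
    then have "grow k E B (X \<union> B)" using grow_Un[OF _ grow.start, of k E "B - {b}" X B] by blast
    moreover have "X \<union> B = X" using grow_superset[of k E "B - {b}" X] * by blast
    ultimately show "grow k E B X" by simp
  next
    assume *: "grow k E B X"
    then have "grow k E (B - {b}) (X \<union> B)" using grow_Un[OF * gB] by blast
    moreover have "X \<union> B = X" "b \<in> X" using grow_superset[OF *] b by blast+
    ultimately show "grow k E (B - {b}) X \<and> b \<in> X" by simp
  qed
qed

text \<open>Sets grown from the facet either avoid \<open>b\<close> or, by
  \<open>grow_facet_iff\<close>, are grown from \<open>B\<close>. The latter gain one unit of excess
  over the facet, for \<open>b\<close> itself.\<close>

lemma facet_family:
  assumes BV: "B \<subseteq> V" and B: "card B = k + 1" "is_clique E B" and b: "b \<in> B"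
  shows "card {X. grow k E (B - {b}) X} = card (side k E B b) + card {X. grow k E B X}"
    and "excess (B - {b}) {X. grow k E (B - {b}) X} =
      excess (B - {b}) (side k E B b) + excess B {X. grow k E B X} + card {X. grow k E B X}"
proof -
  have split: "{X. grow k E (B - {b}) X} = side k E B b \<union> {X. grow k E B X}"
    unfolding side_def using grow_facet_iff[OF B b] by blast
  have fin: "finite (side k E B b)" "finite {X. grow k E B X}"
    unfolding side_def using finite_family[of "B - {b}" "\<lambda>X. b \<notin> X"]
      finite_family[OF BV, of "\<lambda>_. True"] BV by auto
  have disj: "side k E B b \<inter> {X. grow k E B X} = {}"
    unfolding side_def using grow_superset[of k E B] b by blast
  show "card {X. grow k E (B - {b}) X} = card (side k E B b) + card {X. grow k E B X}"
    unfolding split using fin disj by (rule card_Un_disjoint)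
  have "(\<Sum>X | grow k E B X. card (X - (B - {b}))) = (\<Sum>X | grow k E B X. card (X - B) + 1)"
  proof (rule sum.cong[OF refl])
    fix X assume "X \<in> {X. grow k E B X}"
    then have X: "grow k E B X" by simp
    have "X - (B - {b}) = insert b (X - B)" using grow_superset[OF X] b by blast
    then show "card (X - (B - {b})) = card (X - B) + 1" using grow_finite[OF X BV] b by simp
  qed
  also have "\<dots> = (\<Sum>X | grow k E B X. card (X - B)) + card {X. grow k E B X}"
    by (simp only: sum.distrib card_eq_sum)
  finally show "excess (B - {b}) {X. grow k E (B - {b}) X} =
      excess (B - {b}) (side k E B b) + excess B {X. grow k E B X} + card {X. grow k E B X}"
    unfolding excess_def split using fin disj by (simp add: sum.union_disjoint)
qed

text \<open>Vertices labelled \<open>b\<close> are not adjacent to \<open>b\<close>, so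
  \<open>b\<close> never takes part in attaching them and can be removed. Conversely, a vertex
  attached directly to \<open>B - {b}\<close> can only have the label \<open>b\<close>, and later
  vertices inherit it.\<close>

lemma side_labelled:
  assumes BV: "B \<subseteq> V" and B: "card B = k + 1" "is_clique E B" and b: "b \<in> B"
    and f: "\<And>u. u \<in> V - B \<Longrightarrow> f u \<in> B \<and> {u, f u} \<notin> E"
      "\<And>u w. u \<in> V - B \<Longrightarrow> w \<in> V - B \<Longrightarrow> {u, w} \<in> E \<Longrightarrow> f u = f w"
  shows "bij_betw (insert b) (side k E B b) (labelled k E B f {b})"
proof (rule bij_betw_byWitness[where f' = "\<lambda>X. X - {b}"])
  show "\<forall>Y\<in>side k E B b. insert b Y - {b} = Y" unfolding side_def by auto
  show "\<forall>X\<in>labelled k E B f {b}. insert b (X - {b}) = X"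
    unfolding labelled_def using grow_superset[of k E B] b by blast
  have BbV: "B - {b} \<subseteq> V" using BV by blast
  have "finite B" using BV finite_V by (rule finite_subset)
  then have Bb: "card (B - {b}) = k" "finite (B - {b})" using b B by auto
  have lab: "\<forall>x\<in>Y - B. f x = b" if "grow k E (B - {b}) Y" "b \<notin> Y" for Y
    using that
  proof induction
    case (add X S v)
    note XV = grow_subset[OF add.hyps(1) BbV]
    have "insert v X \<subseteq> V" by (rule grow_subset[OF grow.add[OF add.hyps] BbV])
    then have v: "v \<in> V" by blast
    have IH: "f x = b" if "x \<in> X - B" for x using add.IH add.prems that by blast
    have "f v = b" if "v \<notin> B" "v \<notin> X"
    proof (cases "S \<subseteq> B")
      case True
      then have "S \<subseteq> B - {b}" using add.hyps(2) add.prems by blast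
      then have S: "S = B - {b}" using Bb add.hyps(3) by (intro card_seteq) auto
      have "f v \<in> B" "{v, f v} \<notin> E" using f(1)[of v] v that by auto
      moreover have "v \<noteq> f v" using \<open>f v \<in> B\<close> that(1) by metis
      ultimately show ?thesis using is_cliqueD[OF add.hyps(4), of v "f v"] S by blast
    next
      case False
      then obtain s where s: "s \<in> S" "s \<notin> B" by blast
      then have "v \<noteq> s" using add.hyps(2) that(2) by blast
      then have "{v, s} \<in> E" using s by (intro is_cliqueD[OF add.hyps(4)]) auto
      then have "f v = f s" using f(2)[of v s] v that s add.hyps(2) XV by blast
      then show ?thesis using IH[of s] s add.hyps(2) by blast
    qed
    then show ?case using IH by blast
  qed blast
  show "insert b ` side k E B b \<subseteq> labelled k E B f {b}"
  proof clarify
    fix Y assume "Y \<in> side k E B b"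
    then have Y: "grow k E (B - {b}) Y" "b \<notin> Y" unfolding side_def by auto
    have "grow k E B (Y \<union> B)" using grow_Un[OF Y(1) grow.start] by blast
    moreover have "Y \<union> B = insert b Y" using grow_superset[OF Y(1)] b by blast
    ultimately show "insert b Y \<in> labelled k E B f {b}"
      unfolding labelled_def using lab[OF Y] b by auto
  qed
  have del: "grow k E (B - {b}) (X - {b})" if "grow k E B X" "\<forall>x\<in>X - B. f x = b" for X
    using that
  proof induction
    case start
    show ?case by (rule grow.start)
  next
    case (add X S v)
    have IH: "grow k E (B - {b}) (X - {b})" using add.IH add.prems by blast
    show ?case
    proof (cases "v \<in> X")
      case True
      then show ?thesis using IH by (simp add: insert_absorb)
    next
      case False
      then have vB: "v \<notin> B" using grow_superset[OF add.hyps(1)] by blast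
      have "insert v X \<subseteq> V" by (rule grow_subset[OF grow.add[OF add.hyps] BV])
      then have "{v, b} \<notin> E" using f(1)[of v] add.prems vB by auto
      moreover have "v \<noteq> b" using vB b by blast
      ultimately have "b \<notin> S" using is_cliqueD[OF add.hyps(4), of v b] by blast
      then have "grow k E (B - {b}) (insert v (X - {b}))"
        using add.hyps by (intro grow.add[OF IH]) auto
      moreover have "insert v X - {b} = insert v (X - {b})" using \<open>v \<noteq> b\<close> by blast
      ultimately show ?thesis by simp
    qed
  qed
  then show "(\<lambda>X. X - {b}) ` labelled k E B f {b} \<subseteq> side k E B b"
    unfolding labelled_def side_def by auto
qed

lemma clique_product:
  assumes BV: "B \<subseteq> V" and B: "card B = k + 1" "is_clique E B"
  shows "card {X. grow k E B X} = (\<Prod>b\<in>B. card (side k E B b))"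
    and "mean B {X. grow k E B X} = (\<Sum>b\<in>B. mean (B - {b}) (side k E B b))"
proof -
  from clique_labelling[OF ktree BV B] obtain f where
    f: "\<And>u. u \<in> V - B \<Longrightarrow> f u \<in> B \<and> {u, f u} \<notin> E"
      "\<And>u w. u \<in> V - B \<Longrightarrow> w \<in> V - B \<Longrightarrow> {u, w} \<in> E \<Longrightarrow> f u = f w"
    by metis
  have all: "{X. grow k E B X} = labelled k E B f B"
    unfolding labelled_def using f(1) grow_subset[OF _ BV] by blast
  have fB: "finite B" using BV finite_V by (rule finite_subset)
  have bij: "bij_betw (insert b) (side k E B b) (labelled k E B f {b})" if "b \<in> B" for b
    by (rule side_labelled[OF BV B that f])
  have c: "card (labelled k E B f {b}) = card (side k E B b)" if "b \<in> B" for b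
    using bij_betw_same_card[OF bij[OF that]] by simp
  have e: "excess B (labelled k E B f {b}) = excess (B - {b}) (side k E B b)" if "b \<in> B" for b
  proof -
    have "excess B (labelled k E B f {b}) = (\<Sum>Y\<in>side k E B b. card (insert b Y - B))"
      unfolding excess_def by (rule sum.reindex_bij_betw[OF bij[OF that], symmetric])
    also have "\<dots> = excess (B - {b}) (side k E B b)"
      unfolding excess_def
    proof (rule sum.cong[OF refl])
      fix Y assume "Y \<in> side k E B b"
      then have "insert b Y - B = Y - (B - {b})" using that unfolding side_def by blast
      then show "card (insert b Y - B) = card (Y - (B - {b}))" by simp
    qed
    finally show ?thesis .
  qed
  have e': "mean B (labelled k E B f {b}) = mean (B - {b}) (side k E B b)" if "b \<in> B" for b
    using c[OF that] e[OF that] by (simp add: mean_def)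
  note p = labelled_prod[where f = f, OF BV f(2) fB]
  show "card {X. grow k E B X} = (\<Prod>b\<in>B. card (side k E B b))"
    unfolding all using p c by (simp cong: prod.cong)
  show "mean B {X. grow k E B X} = (\<Sum>b\<in>B. mean (B - {b}) (side k E B b))"
    unfolding all using p e' by (simp cong: sum.cong)
qed

text \<open>This is the formula of the overview; \<open>1 + S\<close> is the mean excess over the
  facet of the sets containing \<open>b\<close>.\<close>

lemma facet_mean:
  assumes BV: "B \<subseteq> V" and B: "card B = k + 1" "is_clique E B" and b: "b \<in> B"
    and P: "P = (\<Prod>c\<in>B. real (card (side k E B c)))"
    and S: "S = (\<Sum>c\<in>B. mean (B - {c}) (side k E B c))"
    and N: "N = real (card (side k E B b))" and m: "m = mean (B - {b}) (side k E B b)"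
  shows "mean (B - {b}) {X. grow k E (B - {b}) X} = (N * m + P * (1 + S)) / (N + P)"
proof -
  have pos: "card (side k E B b) > 0" "card {X. grow k E B X} > 0"
    unfolding side_def using fam_finite_card[of "B - {b}" "\<lambda>X. b \<notin> X"]
      fam_finite_card[OF BV, of "\<lambda>_. True"] BV by auto
  have P': "P = real (card {X. grow k E B X})" unfolding P clique_product(1)[OF BV B] by simp
  have S': "S = mean B {X. grow k E B X}" unfolding S clique_product(2)[OF BV B] ..
  have "real (excess (B - {b}) (side k E B b)) = N * m" unfolding N m mean_def using pos by simp
  moreover have "real (excess B {X. grow k E B X}) = P * S" unfolding P' S' mean_def using pos by simp
  ultimately show ?thesis
    unfolding mean_def[of "B - {b}" "{X. grow k E (B - {b}) X}"] facet_family[OF BV B b]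
    using N P' by (simp add: algebra_simps)
qed

section \<open>Branches at a k-clique\<close>

definition branches :: "'a set \<Rightarrow> 'a set \<Rightarrow> 'a set set" where
  "branches C D = {X. grow k E C X \<and> X \<inter> roots V E C \<subseteq> D}"

lemma roots_finite: "finite (roots V E C)"
  unfolding roots_def using finite_V by simp

lemma branches_bounds:
  assumes "C \<subseteq> V"
  shows "1 + 2 * mean C (branches C D) \<le> real (card (branches C D))"
    and "card (branches C D) \<ge> 2 \<Longrightarrow> mean C (branches C D) \<ge> 1 / 2"
    and "mean C (branches C D) \<ge> 0"
proof -
  have "C \<inter> roots V E C \<subseteq> D" unfolding roots_def by blast
  then show "1 + 2 * mean C (branches C D) \<le> real (card (branches C D))"
    and "card (branches C D) \<ge> 2 \<Longrightarrow> mean C (branches C D) \<ge> 1 / 2"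
    and "mean C (branches C D) \<ge> 0"
    using family_bounds[OF assms, of "\<lambda>X. X \<inter> roots V E C \<subseteq> D"] unfolding branches_def by blast+
qed

lemma branches_roots: "C \<subseteq> V \<Longrightarrow> {X. grow k E C X} = branches C (roots V E C)"
  unfolding branches_def by blast

text \<open>Seen from the (k+1)-clique on \<open>b\<close>, all other branches lie behind
  \<open>C\<close>. This ties the facet formula to products over roots.\<close>

lemma side_branches:
  assumes "b \<in> roots V E C"
  shows "side k E (insert b C) b = branches C (roots V E C - {b})"
proof -
  have "insert b C - {b} = C" using assms unfolding roots_def by blast
  then show ?thesis using assms unfolding side_def branches_def by auto
qed

lemma branches_product:
  assumes C: "C \<subseteq> V" "card C = k" "is_clique E C" and D: "D \<subseteq> roots V E C"
  shows "card (branches C D) = (\<Prod>d\<in>D. card (branches C {d}))"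
    and "mean C (branches C D) = (\<Sum>d\<in>D. mean C (branches C {d}))"
proof -
  have "k > 0" using k2 by simp
  from root_labelling[OF ktree C this] obtain g where
    g: "\<And>u. u \<in> V - C \<Longrightarrow> g u \<in> roots V E C" "\<And>u. u \<in> roots V E C \<Longrightarrow> g u = u"
      "\<And>u w. u \<in> V - C \<Longrightarrow> w \<in> V - C \<Longrightarrow> {u, w} \<in> E \<Longrightarrow> g u = g w"
    by metis
  have fC: "finite C" using C(1) finite_V by (rule finite_subset)
  \<comment> \<open>A grown set containing \<open>x\<close> also contains the root of
    \<open>x\<close>, so restricting the roots restricts all labels, and \<open>branches\<close>
    becomes a labelled family for \<open>g\<close>.\<close>
  have root_in: "g x \<in> X" if "grow k E C X" "x \<in> X - C" for X x
    using that
  proof (induction arbitrary: x)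
    case (add X S v)
    note XV = grow_subset[OF add.hyps(1) C(1)]
    have "insert v X \<subseteq> V" by (rule grow_subset[OF grow.add[OF add.hyps] C(1)])
    then have v: "v \<in> V" by blast
    have "g v \<in> insert v X" if "v \<notin> C" "v \<notin> X"
    proof (cases "S \<subseteq> C")
      case True
      then have "S = C" using fC add.hyps(3) C(2) by (intro card_seteq) auto
      then have "v \<in> roots V E C" using v that add.hyps(4) by (simp add: roots_iff)
      then show ?thesis using g(2) by simp
    next
      case False
      then obtain s where s: "s \<in> S" "s \<notin> C" by blast
      then have "v \<noteq> s" using add.hyps(2) that(2) by blast
      then have "{v, s} \<in> E" using s by (intro is_cliqueD[OF add.hyps(4)]) auto
      then have "g v = g s" using g(3)[of v s] v that s add.hyps(2) XV by blast
      then show ?thesis using add.IH[of s] s add.hyps(2) by auto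
    qed
    then show ?case using add.IH[of x] add.IH[of v] add.prems by (cases "x = v") auto
  qed blast
  have eq: "branches C D = labelled k E C g D" for D
  proof (intro subset_antisym subsetI)
    fix X assume "X \<in> branches C D"
    then have X: "grow k E C X" "X \<inter> roots V E C \<subseteq> D" unfolding branches_def by auto
    have "g x \<in> D" if "x \<in> X - C" for x
      using root_in[OF X(1) that] g(1)[of x] that grow_subset[OF X(1) C(1)] X(2) by blast
    then show "X \<in> labelled k E C g D" using X(1) unfolding labelled_def by blast
  next
    fix X assume X: "X \<in> labelled k E C g D"
    have "x \<in> D" if "x \<in> X \<inter> roots V E C" for x
    proof -
      have "x \<in> X - C" "g x = x" using that g(2)[of x] by (auto simp: roots_iff)
      then show ?thesis using X unfolding labelled_def by force
    qed
    then show "X \<in> branches C D" using X unfolding labelled_def branches_def by blast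
  qed
  have "finite D" using D roots_finite by (rule finite_subset)
  from labelled_prod[where f = g, OF C(1) g(3) this]
  show "card (branches C D) = (\<Prod>d\<in>D. card (branches C {d}))"
    and "mean C (branches C D) = (\<Sum>d\<in>D. mean C (branches C {d}))"
    unfolding eq by blast+
qed

lemma roots_nonempty:
  assumes C: "C \<subseteq> V" "card C = k" "is_clique E C" and V: "card V \<ge> k + 1"
  shows "roots V E C \<noteq> {}"
proof -
  have "V - C \<noteq> {}" using C V by (metis Diff_eq_empty_iff Suc_eq_plus1 not_less_eq_eq order_refl subset_antisym)
  moreover have "k > 0" using k2 by simp
  ultimately show ?thesis using root_labelling[OF ktree C] by blast
qed

section \<open>Local mean order and degree in terms of grown sets\<close>

lemma mu_mean:
  assumes C: "C \<subseteq> V" "card C = k" "is_clique E C"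
  shows "mu k V E C = real k + mean C {X. grow k E C X}"
proof -
  let ?H = "{X. grow k E C X}"
  have "k > 0" using k2 by simp
  note bij = sub_ktrees_grow[OF ktree C this]
  have fC: "finite C" using C(1) finite_V by (rule finite_subset)
  have pos: "card ?H > 0" using fam_finite_card[OF C(1), of "\<lambda>_. True"] by simp
  have N: "N_sub k V E C = card ?H" unfolding N_sub_def by (rule bij_betw_same_card[OF bij])
  have "R_sub k V E C = (\<Sum>X\<in>?H. card X)"
    unfolding R_sub_def using sum.reindex_bij_betw[OF bij, of card] by (simp add: case_prod_beta)
  also have "\<dots> = (\<Sum>X\<in>?H. k + card (X - C))"
  proof (rule sum.cong[OF refl])
    fix X assume "X \<in> ?H"
    then have "C \<subseteq> X" "finite X" using grow_superset grow_finite[OF _ C(1)] by blast+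
    then show "card X = k + card (X - C)"
      using C(2) fC card_mono[of X C] by (simp add: card_Diff_subset)
  qed
  also have "\<dots> = k * card ?H + excess C ?H" unfolding excess_def by (simp add: sum.distrib)
  finally show ?thesis unfolding mu_def N mean_def using pos by (simp add: add_divide_distrib)
qed

lemma clique_degree_roots:
  assumes C: "C \<subseteq> V" "card C = k" "is_clique E C"
  shows "clique_degree k V E C = card (roots V E C)"
proof -
  have fC: "finite C" using C(1) finite_V by (rule finite_subset)
  have "bij_betw (\<lambda>b. insert b C) (roots V E C) {Q. kclique (k + 1) V E Q \<and> C \<subseteq> Q}"
    unfolding bij_betw_def
  proof (intro conjI subset_antisym subsetI)
    show "inj_on (\<lambda>b. insert b C) (roots V E C)"
      by (rule inj_onI) (auto simp: roots_iff)
    show "Q \<in> {Q. kclique (k + 1) V E Q \<and> C \<subseteq> Q}" if "Q \<in> (\<lambda>b. insert b C) ` roots V E C" for Q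
      using that C fC by (auto simp: roots_iff kclique_def)
    show "Q \<in> (\<lambda>b. insert b C) ` roots V E C" if "Q \<in> {Q. kclique (k + 1) V E Q \<and> C \<subseteq> Q}" for Q
    proof -
      have Q: "Q \<subseteq> V" "card Q = k + 1" "is_clique E Q" "C \<subseteq> Q" using that by (auto simp: kclique_def)
      have "card (Q - C) = 1" using Q C fC by (simp add: card_Diff_subset)
      then obtain b where "Q - C = {b}" by (auto simp: card_1_singleton_iff)
      then have "Q = insert b C" "b \<notin> C" using Q by blast+
      then show ?thesis using Q by (auto simp: roots_iff)
    qed
  qed
  then show ?thesis unfolding clique_degree_def by (rule bij_betw_same_card[symmetric])
qed

end

section \<open>Passing from a k-clique to a neighbouring facet\<close>

context ktree_graph
begin

lemma root_clique:
  assumes C: "C \<subseteq> V" "card C = k" and b: "b \<in> roots V E C"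
  shows "insert b C \<subseteq> V" "card (insert b C) = k + 1" "is_clique E (insert b C)" "insert b C - {b} = C"
    and "b \<notin> C" "finite C"
  using assms finite_subset[OF C(1) finite_V] by (auto simp: roots_iff)

text \<open>For \<open>c\<close> in \<open>C\<close>, this is the weight behind the neighbouring
  facet \<open>insert b C - {c}\<close>; the value 1 means that this facet has degree 1. For
  \<open>c = b\<close> the facet is \<open>C\<close>, with the other branches behind it.\<close>

definition out_card :: "'a set \<Rightarrow> 'a \<Rightarrow> 'a \<Rightarrow> real" where
  "out_card C b c = real (card (side k E (insert b C) c))"

definition out_mean :: "'a set \<Rightarrow> 'a \<Rightarrow> 'a \<Rightarrow> real" where
  "out_mean C b c = mean (insert b C - {c}) (side k E (insert b C) c)"

lemma out_bounds:
  assumes C: "C \<subseteq> V" "card C = k" and b: "b \<in> roots V E C"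
  shows "out_mean C b c \<ge> 0" "out_card C b c \<ge> 1 + 2 * out_mean C b c"
    and "out_card C b c \<noteq> 1 \<Longrightarrow> out_card C b c \<ge> 2 \<and> out_mean C b c \<ge> 1 / 2"
    and "out_card C b c = 2 \<or> out_card C b c \<le> 1 \<or> out_card C b c \<ge> 3"
proof -
  note B = root_clique(1)[OF assms]
  show 1: "out_mean C b c \<ge> 0" "out_card C b c \<ge> 1 + 2 * out_mean C b c"
    unfolding out_mean_def out_card_def using side_bounds[OF B] by blast+
  show "out_card C b c \<ge> 2 \<and> out_mean C b c \<ge> 1 / 2" if "out_card C b c \<noteq> 1"
  proof -
    have "card (side k E (insert b C) c) \<ge> 2" using 1 that unfolding out_card_def by linarith
    then show ?thesis unfolding out_mean_def out_card_def using side_bounds(2)[OF B] by simp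
  qed
  show "out_card C b c = 2 \<or> out_card C b c \<le> 1 \<or> out_card C b c \<ge> 3"
  proof -
    have "card (side k E (insert b C) c) = 2 \<or> card (side k E (insert b C) c) \<le> 1
      \<or> card (side k E (insert b C) c) \<ge> 3" by linarith
    then show ?thesis unfolding out_card_def by auto
  qed
qed

lemma out_prod_ge_1:
  assumes "C \<subseteq> V" "card C = k" "b \<in> roots V E C" "I \<subseteq> C"
  shows "1 \<le> (\<Prod>c\<in>I. out_card C b c)"
  using out_bounds(1,2)[OF assms(1-3)] by (intro prod_ge_1) (smt (verit))

text \<open>Both means share the term \<open>N0 * M * (1 + m0 + A)\<close>, coming from the sets
  that contain the whole (k+1)-clique.\<close>

lemma facet_means:
  assumes C: "C \<subseteq> V" "card C = k" and b: "b \<in> roots V E C"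
    and M: "M = (\<Prod>c\<in>C. out_card C b c)" and A: "A = (\<Sum>c\<in>C. out_mean C b c)"
    and N0: "N0 = real (card (branches C (roots V E C - {b})))"
    and m0: "m0 = mean C (branches C (roots V E C - {b}))"
  shows "mean C {X. grow k E C X} = (N0 * m0 + N0 * M * (1 + m0 + A)) / (N0 + N0 * M)"
    and "c \<in> C \<Longrightarrow> mean (insert b C - {c}) {X. grow k E (insert b C - {c}) X} =
      (out_card C b c * out_mean C b c + N0 * M * (1 + m0 + A)) / (out_card C b c + N0 * M)"
    and "real (card {X. grow k E C X}) = N0 + N0 * M"
proof -
  note B = root_clique[OF C b]
  have b0: "out_card C b b = N0" "out_mean C b b = m0"
    unfolding N0 m0 out_card_def out_mean_def side_branches[OF b] B(4) by simp_all
  have P: "N0 * M = (\<Prod>c\<in>insert b C. real (card (side k E (insert b C) c)))"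
    unfolding out_card_def[symmetric] using B b0 M by simp
  have S: "m0 + A = (\<Sum>c\<in>insert b C. mean (insert b C - {c}) (side k E (insert b C) c))"
    unfolding out_mean_def[symmetric] using B b0 A by simp
  note f = facet_mean[OF B(1-3) _ P S out_card_def out_mean_def, unfolded add.assoc[symmetric]]
  show "mean C {X. grow k E C X} = (N0 * m0 + N0 * M * (1 + m0 + A)) / (N0 + N0 * M)"
    using f[of b] unfolding B(4) b0 by simp
  show "c \<in> C \<Longrightarrow> mean (insert b C - {c}) {X. grow k E (insert b C - {c}) X} =
      (out_card C b c * out_mean C b c + N0 * M * (1 + m0 + A)) / (out_card C b c + N0 * M)"
    using f[of c] by simp
  have "real (card {X. grow k E C X}) = out_card C b b + real (card {X. grow k E (insert b C) X})"
    using facet_family(1)[OF B(1-3), of b] unfolding B(4) out_card_def by simp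
  then show "real (card {X. grow k E C X}) = N0 + N0 * M"
    unfolding b0 P clique_product(1)[OF B(1-3)] by simp
qed

text \<open>The sets grown from \<open>C\<close> number \<open>N0 + N0 * M\<close> and also factor
  into \<open>N0\<close> and the branch of \<open>b\<close>, so dividing by \<open>N0\<close>
  isolates the branch. The summand 1 counts \<open>C\<close> itself.\<close>

lemma branch_values:
  assumes C: "C \<subseteq> V" "card C = k" "is_clique E C" and b: "b \<in> roots V E C"
    and M: "M = (\<Prod>c\<in>C. out_card C b c)" and A: "A = (\<Sum>c\<in>C. out_mean C b c)"
  shows "real (card (branches C {b})) = 1 + M"
    and "mean C (branches C {b}) = M * (1 + A) / (1 + M)"
proof -
  let ?R = "roots V E C"
  define N0 where "N0 = real (card (branches C (?R - {b})))"
  define m0 where "m0 = mean C (branches C (?R - {b}))"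
  note f = facet_means[OF C(1,2) b M A N0_def m0_def]
  have N0: "N0 > 0" using branches_bounds(1,3)[OF C(1), of "?R - {b}"] unfolding N0_def by simp
  have M1: "M \<ge> 1" unfolding M using out_prod_ge_1[OF C(1,2) b] by blast
  have sub: "?R - {b} \<subseteq> ?R" by blast
  have "real (card (branches C ?R)) = real (card (branches C {b})) * N0"
    unfolding N0_def branches_product(1)[OF C order.refl] branches_product(1)[OF C sub]
    using b roots_finite by (simp add: prod.remove)
  then have "real (card (branches C {b})) * N0 = (1 + M) * N0"
    using f(3) unfolding branches_roots[OF C(1)] by (simp add: algebra_simps)
  then show "real (card (branches C {b})) = 1 + M" using N0 by simp
  have "mean C (branches C ?R) = mean C (branches C {b}) + m0"
    unfolding m0_def branches_product(2)[OF C order.refl] branches_product(2)[OF C sub]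
    using b roots_finite by (simp add: sum.remove)
  then have "mean C (branches C {b}) + m0 = (N0 * m0 + N0 * M * (1 + m0 + A)) / (N0 + N0 * M)"
    using f(1) unfolding branches_roots[OF C(1)] by simp
  also have "\<dots> = N0 * (m0 + M * (1 + m0 + A)) / (N0 * (1 + M))" by (simp add: algebra_simps)
  also have "\<dots> = (m0 + M * (1 + m0 + A)) / (1 + M)" using N0 by simp
  also have "\<dots> = M * (1 + A) / (1 + M) + m0" using M1 by (simp add: field_simps)
  finally show "mean C (branches C {b}) = M * (1 + A) / (1 + M)" by simp
qed

lemma branch_bounds:
  assumes C: "C \<subseteq> V" "card C = k" "is_clique E C" and b: "b \<in> roots V E C"
  shows "real (card (branches C {b})) \<ge> 2" "mean C (branches C {b}) \<ge> 1 / 2"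
    and "real (card (branches C {b})) \<ge> 1 + 2 * mean C (branches C {b})"
proof -
  show 1: "real (card (branches C {b})) \<ge> 2"
    using branch_values(1)[OF C b refl refl] out_prod_ge_1[OF C(1,2) b, of C] by simp
  show "mean C (branches C {b}) \<ge> 1 / 2" using branches_bounds(2)[OF C(1), of "{b}"] 1 by simp
  show "real (card (branches C {b})) \<ge> 1 + 2 * mean C (branches C {b})"
    using branches_bounds(1)[OF C(1)] by blast
qed

section \<open>Cliques of degree at least 2: the case of a neighbouring leaf and the case
  without\<close>

lemma max_leaf:
  assumes C: "C \<subseteq> V" "card C = k" "is_clique E C"
    and max: "\<And>C'. kclique k V E C' \<Longrightarrow> mean C' {X. grow k E C' X} \<le> mean C {X. grow k E C X}"
    and b: "b \<in> roots V E C" "b' \<in> roots V E C" "b' \<noteq> b" and c: "c \<in> C" "out_card C b c = 1"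
  shows "(\<Prod>c\<in>C. out_card C b c) = 1"
    and "real (card (branches C (roots V E C - {b}))) = 1 + 2 * mean C (branches C (roots V E C - {b}))"
proof -
  let ?R = "roots V E C - {b}"
  define N0 where "N0 = real (card (branches C ?R))"
  define m0 where "m0 = mean C (branches C ?R)"
  define M where "M = (\<Prod>c\<in>C. out_card C b c)"
  define A where "A = (\<Sum>c\<in>C. out_mean C b c)"
  note f = facet_means[OF C(1,2) b(1) M_def A_def N0_def m0_def]
  note B = root_clique[OF C(1,2) b(1)]
  have M1: "M \<ge> 1" unfolding M_def using out_prod_ge_1[OF C(1,2) b(1)] by blast
  have A0: "A \<ge> 0" unfolding A_def using out_bounds(1)[OF C(1,2) b(1)] by (simp add: sum_nonneg)
  have N0: "N0 \<ge> 1 + 2 * m0" unfolding N0_def m0_def using branches_bounds(1)[OF C(1)] by blast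
  have sub: "?R \<subseteq> roots V E C" and fR: "finite ?R" using roots_finite by blast+
  \<comment> \<open>The second root \<open>b'\<close> makes \<open>m0\<close> at least 1/2, as
    \<open>leaf_comparison\<close> requires.\<close>
  have "m0 \<ge> mean C (branches C {b'})"
    unfolding m0_def branches_product(2)[OF C sub]
    using fR b branches_bounds(3)[OF C(1)] by (intro member_le_sum) auto
  then have m0: "m0 \<ge> 1 / 2" using branch_bounds(2)[OF C b(2)] by linarith
  have "out_mean C b c = 0" using out_bounds(1,2)[OF C(1,2) b(1), of c] c(2) by linarith
  moreover have "kclique k V E (insert b C - {c})"
    using B c is_clique_subset[OF B(3), of "insert b C - {c}"] C(2) unfolding kclique_def by auto
  ultimately have "N0 * M * (1 + m0 + A) / (1 + N0 * M)
      \<le> (N0 * m0 + N0 * M * (1 + m0 + A)) / (N0 + N0 * M)"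
    using max[of "insert b C - {c}"] f(2)[OF c(1)] f(1) c(2) by simp
  then have "M = 1 \<and> N0 = 1 + 2 * m0" by (rule leaf_comparison[OF N0 m0 M1 A0])
  then show "(\<Prod>c\<in>C. out_card C b c) = 1"
    and "real (card (branches C ?R)) = 1 + 2 * mean C (branches C ?R)"
    unfolding M_def N0_def m0_def by simp_all
qed

lemma distinct_members:
  assumes "card C = k"
  obtains c d where "c \<in> C" "d \<in> C" "c \<noteq> d"
proof -
  have "C \<noteq> {}" using assms k2 by auto
  then obtain c where c: "c \<in> C" by blast
  have "C \<noteq> {c}" using assms k2 by auto
  then show thesis using that c by blast
qed

text \<open>Equality in \<open>N \<ge> 1 + 2 m\<close> leaves a single other root \<open>b'\<close>,
  and then a leaf facet at \<open>b'\<close> too. Applying \<open>max_leaf\<close> with the two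
  roots exchanged shows that both branches have two members, so only four sets are grown from
  \<open>C\<close>.\<close>

lemma max_leaf_order:
  assumes C: "C \<subseteq> V" "card C = k" "is_clique E C"
    and max: "\<And>C'. kclique k V E C' \<Longrightarrow> mean C' {X. grow k E C' X} \<le> mean C {X. grow k E C X}"
    and b: "b \<in> roots V E C" "b' \<in> roots V E C" "b' \<noteq> b" and c: "c \<in> C" "out_card C b c = 1"
  shows "card V = k + 2"
proof -
  let ?R = "roots V E C"
  let ?a = "\<lambda>b. real (card (branches C {b}))" and ?m = "\<lambda>b. mean C (branches C {b})"
  note leaf = max_leaf[OF C max b c]
  have sub: "?R - {b} \<subseteq> ?R" and fR: "finite (?R - {b})" using roots_finite by blast+
  have eq: "(\<Prod>d\<in>?R - {b}. ?a d) = 1 + 2 * (\<Sum>d\<in>?R - {b}. ?m d)"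
    using leaf(2) unfolding branches_product[OF C sub] by simp
  have bnd: "?m d > 0" "?m d \<ge> 0 \<and> ?a d \<ge> 1 + 2 * ?m d" if "d \<in> ?R - {b}" for d
    using branch_bounds[OF C, of d] that by auto
  have "d = b'" if "d \<in> ?R - {b}" for d
  proof (rule ccontr)
    assume "d \<noteq> b'"
    then have "(\<Prod>d\<in>?R - {b}. ?a d) > 1 + 2 * (\<Sum>d\<in>?R - {b}. ?m d)"
      using b that bnd by (intro prod_gt_sum[OF fR, of _ _ d b']) auto
    then show False using eq by simp
  qed
  then have Rb: "?R - {b} = {b'}" and R: "?R = {b, b'}" using b by blast+
  define M where "M = (\<Prod>c\<in>C. out_card C b' c)"
  define A where "A = (\<Sum>c\<in>C. out_mean C b' c)"
  note bv = branch_values[OF C b(2) M_def A_def]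
  have M1: "M \<ge> 1" unfolding M_def using out_prod_ge_1[OF C(1,2) b(2)] by blast
  \<comment> \<open>Equality for the branch of \<open>b'\<close> turns into equality one level
    deeper, for the parts behind its facets.\<close>
  have "?a b' = 1 + 2 * ?m b'" using eq unfolding Rb by simp
  then have "1 + M = 1 + 2 * (M * (1 + A) / (1 + M))" unfolding bv .
  then have "M * (1 + M) = M * (2 * (1 + A))" using M1 by (simp add: field_simps)
  then have MA: "M = 1 + 2 * A" using M1 by simp
  obtain c' where c': "c' \<in> C" "out_card C b' c' = 1"
  proof (rule ccontr)
    assume no: "\<not> thesis"
    \<comment> \<open>Without a leaf facet all means would be positive, and \<open>k2\<close>
      provides two of them; \<open>prod_gt_sum\<close> then contradicts \<open>MA\<close>.\<close>
    obtain i j where ij: "i \<in> C" "j \<in> C" "i \<noteq> j" using distinct_members[OF C(2)] by blast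
    have "out_mean C b' c > 0" if "c \<in> C" for c
      using out_bounds(3)[OF C(1,2) b(2), of c] that no \<open>\<And>c'. c' \<in> C \<Longrightarrow> out_card C b' c' = 1 \<Longrightarrow> thesis\<close>
      by fastforce
    then have "M > 1 + 2 * A" unfolding M_def A_def
      using ij out_bounds(1,2)[OF C(1,2) b(2)] finite_subset[OF C(1) finite_V]
      by (intro prod_gt_sum[of C _ _ i j]) auto
    then show False using MA by simp
  qed
  have "M = 1" unfolding M_def using max_leaf(1)[OF C max b(2,1) _ c'] b(3) by blast
  then have "?a b' = 2" using bv(1) by simp
  moreover have "?a b = 2" using branch_values(1)[OF C b(1) refl refl] leaf(1) by simp
  ultimately have "real (card (branches C ?R)) = 4"
    using branches_product(1)[OF C order.refl] b(3) by (simp add: R)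
  then have card4: "card {X. grow k E C X} = 4" unfolding branches_roots[OF C(1)] by simp
  have bC: "b \<notin> C" "b' \<notin> C" "b \<in> V" "b' \<in> V" and fC: "finite C"
    using b C(1) finite_V finite_subset by (auto simp: roots_iff)
  have g: "grow k E C (insert b C)" "grow k E C (insert b' C)"
    using b C(2) by (auto intro!: grow.add[OF grow.start, of C] simp: roots_iff)
  have "grow k E C (insert b' C \<union> insert b C)" by (rule grow_Un[OF g(2,1)]) blast
  then have "{C, insert b C, insert b' C, insert b' C \<union> insert b C} \<subseteq> {X. grow k E C X}"
    using g grow.start[of k E C] by blast
  moreover have "card {C, insert b C, insert b' C, insert b' C \<union> insert b C} = 4"
  proof -
    have "insert b C \<noteq> insert b' C" "insert b C \<noteq> C" "insert b' C \<noteq> C"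
      "insert b' C \<union> insert b C \<noteq> insert b C" "insert b' C \<union> insert b C \<noteq> insert b' C"
      "insert b' C \<union> insert b C \<noteq> C"
      using bC b(3) by (auto simp: set_eq_iff)
    then show ?thesis by (simp del: Un_insert_left Un_insert_right)
  qed
  ultimately have fam: "{X. grow k E C X} = {C, insert b C, insert b' C, insert b' C \<union> insert b C}"
    using card4 finite_family[OF C(1), of "\<lambda>_. True"]
    by (intro card_subset_eq[symmetric]) (simp_all only: simp_thms)
  have "V \<in> {X. grow k E C X}" using ktree_grow[OF ktree C] by simp
  then have "V = insert b' (insert b C)" using bC b(3) unfolding fam by blast
  then show ?thesis using bC b(3) fC C(2) by simp
qed

text \<open>The branch with least \<open>N / (1 + m)\<close> is entered: minimality supplies the
  hypothesis \<open>key\<close> of \<open>mean_increase\<close>, and the facet is chosen so that the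
  other weights are large enough.\<close>

lemma nonleaf_not_max:
  assumes C: "C \<subseteq> V" "card C = k" "is_clique E C" and two: "card (roots V E C) \<ge> 2"
    and ne: "\<And>b c. b \<in> roots V E C \<Longrightarrow> c \<in> C \<Longrightarrow> out_card C b c \<noteq> 1"
  shows "\<exists>C'. kclique k V E C' \<and> mean C {X. grow k E C X} < mean C' {X. grow k E C' X}"
proof -
  let ?R = "roots V E C"
  let ?a = "\<lambda>b. real (card (branches C {b}))" and ?m = "\<lambda>b. mean C (branches C {b})"
  have fC: "finite C" using C(1) finite_V by (rule finite_subset)
  have fR: "finite ?R" by (rule roots_finite)
  have R0: "?R \<noteq> {}" using two by auto
  obtain b where b: "b \<in> ?R" and min: "\<And>d. d \<in> ?R \<Longrightarrow> ?a b / (1 + ?m b) \<le> ?a d / (1 + ?m d)"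
    by (rule that[OF arg_min_if_finite(1)[OF fR R0] arg_min_least[OF fR R0]])
  have "?R \<noteq> {b}" using two by auto
  then obtain b' where b': "b' \<in> ?R" "b' \<noteq> b" using b by blast
  define N0 where "N0 = real (card (branches C (?R - {b})))"
  define m0 where "m0 = mean C (branches C (?R - {b}))"
  define M where "M = (\<Prod>c\<in>C. out_card C b c)"
  define A where "A = (\<Sum>c\<in>C. out_mean C b c)"
  note f = facet_means[OF C(1,2) b M_def A_def N0_def m0_def]
  note bv = branch_values[OF C b M_def A_def]
  note B = root_clique[OF C(1,2) b]
  have sub: "?R - {b} \<subseteq> ?R" by blast
  \<comment> \<open>Minimality compares \<open>b\<close> with the single root \<open>b'\<close>;
    \<open>q\<close> and \<open>y\<close> collect the remaining branches, controlled by
    \<open>q \<ge> 1 + 2 * y\<close>.\<close>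
  define q where "q = (\<Prod>d\<in>?R - {b} - {b'}. ?a d)"
  define y where "y = (\<Sum>d\<in>?R - {b} - {b'}. ?m d)"
  have N0: "N0 = ?a b' * q" unfolding N0_def q_def branches_product(1)[OF C sub]
    using b' fR prod.remove[of "?R - {b}" b' ?a] by simp
  have m0: "m0 = ?m b' + y" unfolding m0_def y_def branches_product(2)[OF C sub]
    using b' fR sum.remove[of "?R - {b}" b' ?m] by simp
  have qy: "q \<ge> 1 + 2 * y" unfolding q_def y_def
    using fR branches_bounds[OF C(1)] by (intro prod_ge_sum) auto
  have y0: "y \<ge> 0" unfolding y_def using branches_bounds(3)[OF C(1)] by (intro sum_nonneg) auto
  have pos: "?a d \<ge> 2" "?m d \<ge> 1 / 2" if "d \<in> ?R" for d
    using branch_bounds[OF C that] by auto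
  have key: "(1 + M) * (1 + m0) \<le> N0 * (1 + M * (1 + A) / (1 + M))"
  proof -
    have "?a b * (1 + ?m b') \<le> ?a b' * (1 + ?m b)"
      using min[OF b'(1)] pos[OF b] pos[OF b'(1)] by (simp add: field_simps)
    then have "q * (?a b * (1 + ?m b')) \<le> q * (?a b' * (1 + ?m b))"
      using qy y0 by (intro mult_left_mono) auto
    moreover have "?a b * (1 + ?m b' + y) \<le> ?a b * (q * (1 + ?m b'))"
    proof (rule mult_left_mono)
      have "0 \<le> y * ?m b'" using y0 pos(2)[OF b'(1)] by simp
      then have "1 + ?m b' + y \<le> (1 + 2 * y) * (1 + ?m b')" using y0 by (simp add: algebra_simps)
      also have "\<dots> \<le> q * (1 + ?m b')" using qy pos(2)[OF b'(1)] by (intro mult_right_mono) auto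
      finally show "1 + ?m b' + y \<le> q * (1 + ?m b')" .
    qed simp
    ultimately have "?a b * (1 + m0) \<le> N0 * (1 + ?m b)"
      unfolding N0 m0 by (simp add: mult.commute mult.left_commute add.assoc)
    then show ?thesis unfolding bv .
  qed
  have o: "out_card C b c \<ge> 2" "out_mean C b c \<ge> 1 / 2" if "c \<in> C" for c
    using out_bounds(3)[OF C(1,2) b] ne[OF b that] by auto
  \<comment> \<open>Hypothesis \<open>Q'\<close> of \<open>mean_increase\<close>. A weight of at
    least 3 stays in the product if another vertex is left out; if all weights are 2, the product is
    \<open>2 ^ (k - 1)\<close>, which is at least 4 unless \<open>k = 2\<close>.\<close>
  have "\<exists>i\<in>C. (\<Prod>c\<in>C - {i}. out_card C b c) \<ge> 3
      \<or> (\<Prod>c\<in>C - {i}. out_card C b c) = 2 \<and> out_card C b i = 2"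
  proof (cases "\<exists>c\<in>C. out_card C b c \<ge> 3")
    case True
    then obtain c where c: "c \<in> C" "out_card C b c \<ge> 3" by blast
    obtain i where i: "i \<in> C" "i \<noteq> c" using distinct_members[OF C(2)] by metis
    have "(\<Prod>c\<in>C - {i}. out_card C b c) = out_card C b c * (\<Prod>c\<in>C - {i} - {c}. out_card C b c)"
      using c i fC by (intro prod.remove) auto
    moreover have "1 \<le> (\<Prod>c\<in>C - {i} - {c}. out_card C b c)"
      by (rule out_prod_ge_1[OF C(1,2) b]) blast
    then have "3 * 1 \<le> out_card C b c * (\<Prod>c\<in>C - {i} - {c}. out_card C b c)"
      using c(2) by (intro mult_mono) auto
    ultimately show ?thesis using i(1) by (intro bexI[of _ i] disjI1) simp_all
  next
    case False
    then have 2: "out_card C b c = 2" if "c \<in> C" for c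
      using out_bounds(4)[OF C(1,2) b, of c] o(1)[OF that] that by fastforce
    obtain i where i: "i \<in> C" using distinct_members[OF C(2)] by metis
    have "(\<Prod>c\<in>C - {i}. out_card C b c) = (\<Prod>c\<in>C - {i}. 2)" by (rule prod.cong) (auto simp: 2)
    also have "\<dots> = 2 ^ (k - 1)" using i fC C(2) by simp
    finally have Q: "(\<Prod>c\<in>C - {i}. out_card C b c) = 2 ^ (k - 1)" .
    show ?thesis
    proof (cases "k = 2")
      case True
      then show ?thesis using Q 2[OF i] i by auto
    next
      case False
      then have "(2::real) ^ 2 \<le> 2 ^ (k - 1)" using k2 by (intro power_increasing) auto
      then show ?thesis using Q i by (intro bexI[of _ i] disjI1) simp_all
    qed
  qed
  then obtain i where i: "i \<in> C" and Q3: "(\<Prod>c\<in>C - {i}. out_card C b c) \<ge> 3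
      \<or> (\<Prod>c\<in>C - {i}. out_card C b c) = 2 \<and> out_card C b i = 2" by blast
  define Q where "Q = (\<Prod>c\<in>C - {i}. out_card C b c)"
  define x where "x = (\<Sum>c\<in>C - {i}. out_mean C b c)"
  have M: "M = out_card C b i * Q" unfolding M_def Q_def using i fC by (intro prod.remove)
  have A: "A = out_mean C b i + x" unfolding A_def x_def using i fC by (intro sum.remove)
  have Qx: "Q \<ge> 1 + 2 * x" unfolding Q_def x_def
    using fC out_bounds(1,2)[OF C(1,2) b] by (intro prod_ge_sum) auto
  have x0: "x \<ge> 0" unfolding x_def using out_bounds(1)[OF C(1,2) b] by (intro sum_nonneg) auto
  have m00: "m0 \<ge> 0" "N0 \<ge> 1"
    using branches_bounds(1,3)[OF C(1), of "?R - {b}"] unfolding m0_def N0_def by auto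
  have "(N0 * m0 + N0 * M * (1 + m0 + A)) / (N0 + N0 * M)
    < (out_card C b i * out_mean C b i + N0 * M * (1 + m0 + A)) / (out_card C b i + N0 * M)"
    unfolding M A
    by (rule mean_increase[OF m00(2,1) o[OF i] Qx x0 Q3[folded Q_def] key[unfolded M A]])
  then have "mean C {X. grow k E C X} < mean (insert b C - {i}) {X. grow k E (insert b C - {i}) X}"
    unfolding f(1) f(2)[OF i] .
  moreover have "kclique k V E (insert b C - {i})"
    using B i is_clique_subset[OF B(3), of "insert b C - {i}"] C(2) unfolding kclique_def by auto
  ultimately show ?thesis by blast
qed

text \<open>The family has either four members of excess 0, 1, 1, 2 or three of excess 0, 1, 2; the
  mean is 1 both times.\<close>

lemma mean_order_k_plus_2:
  assumes C: "C \<subseteq> V" "card C = k" "is_clique E C" and V: "card V = k + 2"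
  shows "mean C {X. grow k E C X} = 1"
proof -
  let ?H = "{X. grow k E C X}"
  have fC: "finite C" using C(1) finite_V by (rule finite_subset)
  have VH: "grow k E C V" by (rule ktree_grow[OF ktree C])
  have c2: "card (V - C) = 2" using V C fC by (simp add: card_Diff_subset)
  then have "V - C \<noteq> {}" by (metis card.empty zero_neq_numeral)
  \<comment> \<open>As \<open>w\<close> is removable from \<open>V\<close>, the other vertex
    \<open>u\<close> attaches directly to \<open>C\<close>; whether \<open>w\<close> does too gives
    the two cases.\<close>
  then obtain w where w: "w \<in> V - C" "grow k E C (V - {w})" using grow_accessible[OF VH] by blast
  have "card (V - C - {w}) = 1" using c2 w(1) finite_V by simp
  then obtain u where u: "V - C - {w} = {u}" by (auto simp: card_1_singleton_iff)
  have uw: "u \<notin> C" "w \<notin> C" "u \<noteq> w" and Veq: "V = insert u (insert w C)" using u w(1) C(1) by blast+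
  have uH: "grow k E C (insert u C)"
  proof -
    have "V - {w} = insert u C" using uw unfolding Veq by blast
    then show ?thesis using w(2) by simp
  qed
  have sub: "X = C \<or> X = insert u C \<or> X = insert w C \<or> X = V" if "X \<in> ?H" for X
  proof -
    have "C \<subseteq> X" "X \<subseteq> insert u (insert w C)"
      using that grow_superset grow_subset[OF _ C(1)] unfolding Veq[symmetric] by blast+
    then show ?thesis unfolding Veq by blast
  qed
  have neq: "C \<noteq> insert u C" "C \<noteq> insert w C" "C \<noteq> V" "insert u C \<noteq> insert w C"
    "insert u C \<noteq> V" "insert w C \<noteq> V"
    using uw unfolding Veq by (auto simp: set_eq_iff)
  have cu: "card (insert u C - C) = 1" "card (insert w C - C) = 1"
  proof -
    have "insert u C - C = {u}" "insert w C - C = {w}" using uw by blast+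
    then show "card (insert u C - C) = 1" "card (insert w C - C) = 1" by simp_all
  qed
  show ?thesis
  proof (cases "grow k E C (insert w C)")
    case True
    then have "?H = {C, insert u C, insert w C, V}" using sub VH uH grow.start[of k E C] by blast
    then show ?thesis using neq cu c2 by (simp add: mean_def excess_def del: insert_Diff_single)
  next
    case False
    then have "?H = {C, insert u C, V}" using sub VH uH grow.start[of k E C] by blast
    then show ?thesis using neq cu c2 by (simp add: mean_def excess_def)
  qed
qed

end

theorem theorem1p3:
  fixes k :: nat and V :: "'a set" and E :: "'a set set"
  assumes "k \<ge> 2" and "ktree k V E" and "card V \<ge> k + 1"
  shows "(card V \<noteq> k + 2 \<longrightarrow>
            (\<forall>C. kclique k V E C \<and> (\<forall>C'. kclique k V E C' \<longrightarrow> mu k V E C' \<le> mu k V E C)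
                 \<longrightarrow> clique_degree k V E C = 1))
       \<and> (card V = k + 2 \<longrightarrow> (\<forall>C. kclique k V E C \<longrightarrow> mu k V E C = real k + 1))"
proof -
  interpret ktree_graph k V E using assms(1,2) by unfold_locales
  show ?thesis
  proof (intro conjI impI allI)
    fix C
    assume n: "card V \<noteq> k + 2"
      and "kclique k V E C \<and> (\<forall>C'. kclique k V E C' \<longrightarrow> mu k V E C' \<le> mu k V E C)"
    then have C: "C \<subseteq> V" "card C = k" "is_clique E C"
      and mu: "\<And>C'. kclique k V E C' \<Longrightarrow> mu k V E C' \<le> mu k V E C"
      unfolding kclique_def by blast+
    \<comment> \<open>\<open>mu\<close> and the mean excess differ by the constant \<open>k\<close>,
      so they have the same maximizers.\<close>
    have max: "mean C' {X. grow k E C' X} \<le> mean C {X. grow k E C X}" if "kclique k V E C'" for C'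
      using mu[OF that] mu_mean[OF C] mu_mean[of C'] that unfolding kclique_def by simp
    show "clique_degree k V E C = 1"
    proof (rule ccontr)
      assume "clique_degree k V E C \<noteq> 1"
      moreover have "card (roots V E C) \<noteq> 0"
        using roots_nonempty[OF C assms(3)] roots_finite by (simp add: card_eq_0_iff)
      ultimately have two: "card (roots V E C) \<ge> 2" using clique_degree_roots[OF C] by simp
      \<comment> \<open>If no neighbouring facet had weight 1, \<open>nonleaf_not_max\<close> would
        contradict maximality.\<close>
      obtain b c where b: "b \<in> roots V E C" and c: "c \<in> C" "out_card C b c = 1"
        using nonleaf_not_max[OF C two] max by fastforce
      have "roots V E C \<noteq> {b}" using two by auto
      then obtain b' where "b' \<in> roots V E C" "b' \<noteq> b" using b by blast
      then show False using max_leaf_order[OF C max b _ _ c] n by blast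
    qed
  next
    fix C assume "card V = k + 2" "kclique k V E C"
    then show "mu k V E C = real k + 1"
      using mu_mean[of C] mean_order_k_plus_2[of C] unfolding kclique_def by simp
  qed
qed

end
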